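(* Let $\mathcal{H}$ be a complex infinite-dimensional Hilbert space and let $\mathbf{T}=(T_1,T_2)$ be a commuting pair of bounded linear operators on $\mathcal{H}$, with spherical Aluthge transform $\widehat{\mathbf{T}}$. Then $$\sigma_T(\mathbf{T})=\sigma_T(\widehat{\mathbf{T}}),$$ where $\sigma_T$ denotes the Taylor spectrum.
   Context: Canonical joint polar decomposition: for a commuting pair $\mathbf{T}=(T_1,T_2)$ of bounded operators on $\mathcal{H}$, consider the polar decomposition of the column operator $\begin{pmatrix} T_1 \\ T_2 \end{pmatrix}:\mathcal{H}\to\mathcal{H}\oplus\mathcal{H}$, namely $\begin{pmatrix} T_1 \\ T_2 \end{pmatrix}=\begin{pmatrix} V_1 \\ V_2 \end{pmatrix}P$, where $P=\sqrt{T_1^*T_1+T_2^*T_2}$ and $\begin{pmatrix} V_1 \\ V_2 \end{pmatrix}:\mathcal{H}\to\mathcal{H}\oplus\mathcal{H}$ is a partial isometry, subject to $\ker T_1\cap\ker T_2=\ker V_1\cap\ker V_2=\ker P$. The spherical Aluthge transform of $\mathbf{T}$ is $\widehat{\mathbf{T}}:=(\sqrt{P}V_1\sqrt{P},\sqrt{P}V_2\sqrt{P})$, which is necessarily a commuting pair. For a commuting pair $\mathbf{S}=(S_1,S_2)$ on $\mathcal{H}$, the Koszul complex $K(\mathbf{S},\mathcal{H})$ is $$0\to\mathcal{H}\xrightarrow{\begin{pmatrix} S_1 \\ S_2 \end{pmatrix}}\mathcal{H}\oplus\mathcal{H}\xrightarrow{(-S_2\ \ S_1)}\mathcal{H}\to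 0.$$ The pair $\mathbf{S}$ is (Taylor) invertible if $K(\mathbf{S},\mathcal{H})$ is exact. The Taylor spectrum of $\mathbf{S}$ is $$\sigma_T(\mathbf{S}):=\{(\lambda_1,\lambda_2)\in\mathbb{C}^2:(S_1-\lambda_1,S_2-\lambda_2)\text{ is not (Taylor) invertible}\}.$$ *)

theory Defs
  imports "HOL-Analysis.Analysis"
begin

class complex_vector = real_vector +
  fixes scaleC :: "complex \<Rightarrow> 'a \<Rightarrow> 'a"  (infixr "*\<^sub>C" 75)
  assumes scaleC_add_right: "a *\<^sub>C (x + y) = a *\<^sub>C x + a *\<^sub>C y"
    and scaleC_add_left: "(a + b) *\<^sub>C x = a *\<^sub>C x + b *\<^sub>C x"
    and scaleC_scaleC: "a *\<^sub>C (b *\<^sub>C x) = (a * b) *\<^sub>C x"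
    and scaleC_one: "1 *\<^sub>C x = x"
    and scaleR_scaleC: "r *\<^sub>R x = complex_of_real r *\<^sub>C x"

global_interpretation complex_vector:
  vector_space "scaleC :: complex \<Rightarrow> 'a \<Rightarrow> 'a::complex_vector"
  defines cspan_raw_def: cspan = complex_vector.span
  by unfold_locales (fact scaleC_add_right scaleC_add_left scaleC_scaleC scaleC_one)+

text \<open>
  Complex Hilbert spaces. The inner product is linear in its first argument, and its real
  part is the real inner product of the underlying real Hilbert space, so that norm, topology
  and completeness are those of the library.
\<close>

class chilbert_space = complex_vector + real_inner + complete_space +
  fixes cinner :: "'a \<Rightarrow> 'a \<Rightarrow> complex"
  assumes cinner_commute: "cinner x y = cnj (cinner y x)"
    and cinner_add_left: "cinner (x + y) z = cinner x z + cinner y z"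
    and cinner_scaleC_left: "cinner (a *\<^sub>C x) y = a * cinner x y"
    and inner_eq_Re_cinner: "inner x y = Re (cinner x y)"

text \<open>The orthogonal direct sum of two Hilbert spaces is the product type.\<close>

instantiation prod :: (complex_vector, complex_vector) complex_vector
begin

definition scaleC_prod :: "complex \<Rightarrow> 'a \<times> 'b \<Rightarrow> 'a \<times> 'b" where
  "scaleC_prod a p = (a *\<^sub>C fst p, a *\<^sub>C snd p)"

instance
  by standard
    (simp_all add: scaleC_prod_def prod_eq_iff scaleC_add_right scaleC_add_left
      scaleC_scaleC scaleC_one scaleR_scaleC)

end

instantiation prod :: (chilbert_space, chilbert_space) chilbert_space
begin

definition cinner_prod :: "'a \<times> 'b \<Rightarrow> 'a \<times> 'b \<Rightarrow> complex" where
  "cinner_prod p q = cinner (fst p) (fst q) + cinner (snd p) (snd q)"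

instance
proof
  fix x y z :: "'a \<times> 'b" and a :: complex
  show "cinner x y = cnj (cinner y x)"
    unfolding cinner_prod_def by (simp flip: cinner_commute)
  show "cinner (x + y) z = cinner x z + cinner y z"
    by (simp add: cinner_prod_def cinner_add_left)
  show "cinner (a *\<^sub>C x) y = a * cinner x y"
    by (simp add: cinner_prod_def scaleC_prod_def cinner_scaleC_left distrib_left)
  show "inner x y = Re (cinner x y)"
    by (simp add: cinner_prod_def inner_prod_def inner_eq_Re_cinner)
qed

end

definition bounded_clinear :: "('a::chilbert_space \<Rightarrow> 'b::chilbert_space) \<Rightarrow> bool" where
  "bounded_clinear T \<longleftrightarrow> bounded_linear T \<and> (\<forall>a x. T (a *\<^sub>C x) = a *\<^sub>C T x)"

definition op_ker :: "('a::chilbert_space \<Rightarrow> 'b::chilbert_space) \<Rightarrow> 'a set" where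
  "op_ker T = {x. T x = 0}"

definition cadjoint :: "('a::chilbert_space \<Rightarrow> 'b::chilbert_space) \<Rightarrow> 'b \<Rightarrow> 'a" where
  "cadjoint T = (THE S. bounded_clinear S \<and> (\<forall>x y. cinner (T x) y = cinner x (S y)))"

definition positive_op :: "('a::chilbert_space \<Rightarrow> 'a) \<Rightarrow> bool" where
  "positive_op A \<longleftrightarrow> bounded_clinear A \<and> (\<forall>x. cinner (A x) x \<in> \<real>\<^sub>\<ge>\<^sub>0)"

text \<open>The unique positive square root of a positive operator.\<close>

definition op_sqrt :: "('a::chilbert_space \<Rightarrow> 'a) \<Rightarrow> 'a \<Rightarrow> 'a" where
  "op_sqrt A = (THE B. positive_op B \<and> B \<circ> B = A)"

definition partial_isometry :: "('a::chilbert_space \<Rightarrow> 'b::chilbert_space) \<Rightarrow> bool" where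
  "partial_isometry V \<longleftrightarrow> bounded_clinear V \<and>
    (\<forall>x. (\<forall>z\<in>op_ker V. cinner x z = 0) \<longrightarrow> norm (V x) = norm x)"

definition column :: "('a \<Rightarrow> 'a) \<times> ('a \<Rightarrow> 'a) \<Rightarrow> 'a \<Rightarrow> 'a \<times> 'a::chilbert_space" where
  "column S = (\<lambda>x. (fst S x, snd S x))"

definition joint_modulus :: "('a \<Rightarrow> 'a) \<times> ('a \<Rightarrow> 'a) \<Rightarrow> 'a \<Rightarrow> 'a::chilbert_space" where
  "joint_modulus T =
    op_sqrt (\<lambda>x. cadjoint (fst T) (fst T x) + cadjoint (snd T) (snd T x))"

text \<open>The pair \<open>(V\<^sub>1, V\<^sub>2)\<close> of the canonical joint polar decomposition.\<close>

definition polar_part ::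
  "('a \<Rightarrow> 'a) \<times> ('a \<Rightarrow> 'a) \<Rightarrow> ('a \<Rightarrow> 'a) \<times> ('a \<Rightarrow> 'a::chilbert_space)" where
  "polar_part T = (THE V.
    column T = column V \<circ> joint_modulus T \<and>
    partial_isometry (column V) \<and>
    op_ker (fst T) \<inter> op_ker (snd T) = op_ker (fst V) \<inter> op_ker (snd V) \<and>
    op_ker (fst V) \<inter> op_ker (snd V) = op_ker (joint_modulus T))"

definition spherical_aluthge ::
  "('a \<Rightarrow> 'a) \<times> ('a \<Rightarrow> 'a) \<Rightarrow> ('a \<Rightarrow> 'a) \<times> ('a \<Rightarrow> 'a::chilbert_space)" where
  "spherical_aluthge T =
    (let R = op_sqrt (joint_modulus T); V = polar_part T
     in (R \<circ> fst V \<circ> R, R \<circ> snd V \<circ> R))"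

definition commuting_pair :: "('a::chilbert_space \<Rightarrow> 'a) \<times> ('a \<Rightarrow> 'a) \<Rightarrow> bool" where
  "commuting_pair S \<longleftrightarrow>
    bounded_clinear (fst S) \<and> bounded_clinear (snd S) \<and> fst S \<circ> snd S = snd S \<circ> fst S"

text \<open>The second boundary map of the Koszul complex; the first one is \<^const>\<open>column\<close>.\<close>

definition koszul_row :: "('a \<Rightarrow> 'a) \<times> ('a \<Rightarrow> 'a) \<Rightarrow> 'a \<times> 'a \<Rightarrow> 'a::chilbert_space" where
  "koszul_row S = (\<lambda>(x, y). - snd S x + fst S y)"

definition taylor_invertible :: "('a::chilbert_space \<Rightarrow> 'a) \<times> ('a \<Rightarrow> 'a) \<Rightarrow> bool" where
  "taylor_invertible S \<longleftrightarrow>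
    op_ker (column S) = {0} \<and>
    range (column S) = op_ker (koszul_row S) \<and>
    range (koszul_row S) = UNIV"

definition taylor_spectrum ::
  "('a::chilbert_space \<Rightarrow> 'a) \<times> ('a \<Rightarrow> 'a) \<Rightarrow> (complex \<times> complex) set" where
  "taylor_spectrum S = {(l1, l2).
    \<not> taylor_invertible (\<lambda>x. fst S x - l1 *\<^sub>C x, \<lambda>x. snd S x - l2 *\<^sub>C x)}"

end

theory Submission
  imports Defs
begin

text \<open>
  Write \<open>T\<^sub>i = V\<^sub>i P\<close> and \<open>R\<close> for the square root of \<open>P\<close>. Commutativity of \<open>T\<close> gives
  \<open>V\<^sub>1 P V\<^sub>2 = V\<^sub>2 P V\<^sub>1\<close> on the closure of the range of \<open>P\<close>, and both sides vanish on its kernel.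
  With \<open>A\<^sub>i = V\<^sub>i R\<close> we have \<open>T\<^sub>i = A\<^sub>i R\<close>, the Aluthge transform is \<open>(R A\<^sub>1, R A\<^sub>2)\<close>, and
  \<open>A\<^sub>1 R A\<^sub>2 = A\<^sub>2 R A\<^sub>1\<close>. Hence \<open>R\<close> and each \<open>A\<^sub>i\<close> are chain maps between the two Koszul complexes
  shifted by \<open>\<lambda>\<close>, and their composites \<open>A\<^sub>i R\<close> and \<open>R A\<^sub>i\<close> act on homology as \<open>\<lambda>\<^sub>i\<close>; this settles
  \<open>\<lambda> \<noteq> 0\<close>. At \<open>\<lambda> = 0\<close>, exactness of either complex forces \<open>R\<close> to be bijective, and then \<open>R\<close> is a
  similarity between the two pairs.
\<close>

section \<open>Elementary facts about quadratic forms and inner products\<close>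

text \<open>Serves twice: for the orthogonality of the residual at a nearest point, and for the
  Cauchy-Schwarz inequality of a semidefinite form.\<close>

lemma nonneg_quadratic_discriminant:
  fixes a b c :: real
  assumes nonneg: "\<And>t. 0 \<le> a - 2 * t * b + t\<^sup>2 * c" and "0 \<le> c"
  shows "b\<^sup>2 \<le> a * c"
proof (cases "c = 0")
  case True
  have "b = 0"
  proof (rule ccontr)
    assume "b \<noteq> 0"
    then show False
      \<comment> \<open>With \<open>c = 0\<close> the expression is affine in \<open>t\<close>, and
        this \<open>t\<close> gives it the value -1.\<close>
      using nonneg[of "(a + 1) / (2 * b)"] True by (simp add: field_simps)
  qed
  with True show ?thesis by simp
next
  case False
  with \<open>0 \<le> c\<close> have "c > 0" by simp
  then show ?thesis
    \<comment> \<open>The minimiser of the quadratic, where its value is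
      \<open>a - b\<^sup>2 / c\<close>.\<close>
    using nonneg[of "b / c"] by (simp add: field_simps power2_eq_square)
qed

lemma inner_ext:
  fixes u v :: "'a::real_inner"
  assumes "\<And>x. inner x u = inner x v"
  shows "u = v"
proof -
  have "inner (u - v) (u - v) = 0"
    using assms[of "u - v"] by (simp add: inner_diff_right)
  then show ?thesis by simp
qed

subsection \<open>Orthogonal projection and adjoints in real Hilbert spaces\<close>

text \<open>A minimising sequence for the distance from \<open>x\<close> to \<open>S\<close> is
  Cauchy by the parallelogram law. Its limit \<open>d\<close> is a nearest point, and the first
  variation at \<open>d\<close> vanishes.\<close>

lemma orthogonal_projection_exists:
  fixes S :: "'a::{real_inner, banach} set"
  assumes S: "subspace S" "closed S"
  obtains d where "d \<in> S" "\<And>s. s \<in> S \<Longrightarrow> inner (x - d) s = 0"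
proof -
  define D where "D = (\<lambda>s. (norm (x - s))\<^sup>2) ` S"
  define \<delta> where "\<delta> = Inf D"
  have bdd: "bdd_below D"
    by (rule bdd_belowI[of _ 0]) (auto simp: D_def)
  have ne: "D \<noteq> {}"
    using subspace_0[OF S(1)] by (auto simp: D_def)
  have lower: "\<delta> \<le> (norm (x - s))\<^sup>2" if "s \<in> S" for s
    unfolding \<delta>_def by (rule cInf_lower) (use that bdd in \<open>auto simp: D_def\<close>)
  have "\<exists>s\<in>S. (norm (x - s))\<^sup>2 < \<delta> + inverse (real (Suc n))" for n
  proof -
    have "\<exists>r\<in>D. r < \<delta> + inverse (real (Suc n))"
      unfolding \<delta>_def by (subst cInf_less_iff[OF ne bdd, symmetric]) simp
    then show ?thesis by (auto simp: D_def)
  qed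
  then obtain s where s: "\<And>n. s n \<in> S"
    and sd: "\<And>n. (norm (x - s n))\<^sup>2 < \<delta> + inverse (real (Suc n))"
    by metis
  have dist: "(norm (s m - s n))\<^sup>2 \<le> 2 * inverse (real (Suc m)) + 2 * inverse (real (Suc n))" for m n
  proof -
    have "(1/2) *\<^sub>R (s m + s n) \<in> S"
      using S(1) s by (simp add: subspace_add subspace_scale)
    then have "\<delta> \<le> (norm (x - (1/2) *\<^sub>R (s m + s n)))\<^sup>2"
      by (rule lower)
    \<comment> \<open>The parallelogram law for \<open>x - s m\<close> and \<open>x - s n\<close>.
      The midpoint lies in \<open>S\<close>, so its squared distance from \<open>x\<close> is at
      least \<open>\<delta>\<close>.\<close>
    moreover have "(norm (s m - s n))\<^sup>2 + 4 * (norm (x - (1/2) *\<^sub>R (s m + s n)))\<^sup>2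
        = 2 * (norm (x - s m))\<^sup>2 + 2 * (norm (x - s n))\<^sup>2"
      by (simp add: power2_norm_eq_inner algebra_simps inner_commute)
    ultimately show ?thesis
      using sd[of m] sd[of n] by linarith
  qed
  have "Cauchy s"
  proof (rule CauchyI)
    fix e :: real assume "e > 0"
    then have "e\<^sup>2 / 4 > 0" by simp
    then obtain N where N: "inverse (real (Suc N)) < e\<^sup>2 / 4"
      using reals_Archimedean by blast
    have "norm (s m - s n) < e" if "m \<ge> N" "n \<ge> N" for m n
    proof -
      have "inverse (real (Suc m)) \<le> inverse (real (Suc N))"
           "inverse (real (Suc n)) \<le> inverse (real (Suc N))"
        using that by (simp_all add: le_imp_inverse_le)
      with N dist[of m n] have "(norm (s m - s n))\<^sup>2 < e\<^sup>2" by linarith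
      then show ?thesis
        using \<open>e > 0\<close> power2_less_imp_less by fastforce
    qed
    then show "\<exists>M. \<forall>m\<ge>M. \<forall>n\<ge>M. norm (s m - s n) < e" by blast
  qed
  then obtain d where d: "s \<longlonglongrightarrow> d"
    using Cauchy_convergent_iff convergent_def by blast
  have dS: "d \<in> S"
    using S(2) s d closed_sequentially by blast
  have "(norm (x - d))\<^sup>2 \<le> \<delta> + 0"
  proof (rule LIMSEQ_le)
    show "(\<lambda>n. (norm (x - s n))\<^sup>2) \<longlonglongrightarrow> (norm (x - d))\<^sup>2"
      by (intro tendsto_intros d)
    show "(\<lambda>n. \<delta> + inverse (real (Suc n))) \<longlonglongrightarrow> \<delta> + 0"
      by (intro tendsto_intros LIMSEQ_inverse_real_of_nat)
    show "\<exists>N. \<forall>n\<ge>N. (norm (x - s n))\<^sup>2 \<le> \<delta> + inverse (real (Suc n))"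
      using sd less_imp_le by blast
  qed
  then have min: "(norm (x - d))\<^sup>2 \<le> (norm (x - s))\<^sup>2" if "s \<in> S" for s
    using lower[OF that] by linarith
  have "inner (x - d) s = 0" if sS: "s \<in> S" for s
  proof -
    \<comment> \<open>Moving from \<open>d\<close> along \<open>s\<close> cannot decrease the
      distance. The constant term of the difference is 0, so the discriminant bound forces the
      linear coefficient to vanish.\<close>
    have "0 \<le> 0 - 2 * t * inner (x - d) s + t\<^sup>2 * inner s s" for t
    proof -
      have "d + t *\<^sub>R s \<in> S"
        using S(1) sS dS by (simp add: subspace_add subspace_scale)
      then have "(norm (x - d))\<^sup>2 \<le> (norm (x - d - t *\<^sub>R s))\<^sup>2"
        using min[of "d + t *\<^sub>R s"] by (simp add: diff_diff_eq)
      also have "\<dots> = (norm (x - d))\<^sup>2 - 2 * t * inner (x - d) s + t\<^sup>2 * inner s s"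
        unfolding power2_norm_eq_inner inner_diff_left[of "x - d"] inner_diff_right[of _ "x - d"]
        by (simp add: inner_commute[of s "x - d"] power2_eq_square)
      finally show ?thesis by simp
    qed
    from nonneg_quadratic_discriminant[OF this] show ?thesis by simp
  qed
  with dS show ?thesis by (rule that)
qed

text \<open>The kernel of a nonzero \<open>f\<close> is a closed hyperplane. The residual
  \<open>w\<close> of a vector outside it is normal to it, and a multiple of \<open>w\<close>
  represents \<open>f\<close>.\<close>

lemma riesz_representation:
  fixes f :: "'a::{real_inner, banach} \<Rightarrow> real"
  assumes f: "bounded_linear f"
  obtains y where "\<And>x. f x = inner x y"
proof (cases "\<forall>z. f z = 0")
  case True
  then show ?thesis using that[of 0] by simp
next
  case False
  then obtain z where z: "f z \<noteq> 0" by blast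
  interpret f: bounded_linear f by (fact f)
  define S where "S = {x. f x = 0}"
  have "subspace S"
    by (auto simp: S_def subspace_def f.zero f.add f.scaleR)
  moreover have "closed S"
    unfolding S_def by (intro closed_Collect_eq continuous_intros f.continuous_on)
  ultimately obtain d where d: "d \<in> S" "\<And>s. s \<in> S \<Longrightarrow> inner (z - d) s = 0"
    by (rule orthogonal_projection_exists[where x = z]) blast
  define w where "w = z - d"
  have fw: "f w \<noteq> 0"
    using z d(1) by (simp add: w_def S_def f.diff)
  then have w0: "inner w w \<noteq> 0"
    by (auto simp: f.zero)
  have "f x = inner x ((f w / inner w w) *\<^sub>R w)" for x
  proof -
    have "x - (f x / f w) *\<^sub>R w \<in> S"
      using fw by (simp add: S_def f.diff f.scaleR)
    then have "inner w (x - (f x / f w) *\<^sub>R w) = 0"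
      using d(2) by (simp add: w_def)
    then have "inner x w = (f x / f w) * inner w w"
      by (simp add: inner_diff_right inner_commute)
    then show ?thesis using fw w0 by simp
  qed
  then show ?thesis by (rule that)
qed

text \<open>Riesz representation applied to \<open>inner (T x) y\<close> as a functional of
  \<open>x\<close>. The bound on \<open>S y\<close> comes from testing the identity at
  \<open>x = S y\<close>.\<close>

lemma adjoint_exists:
  fixes T :: "'a::{real_inner, banach} \<Rightarrow> 'b::real_inner"
  assumes T: "bounded_linear T"
  obtains S where "bounded_linear S" "\<And>x y. inner (T x) y = inner x (S y)"
proof -
  interpret T: bounded_linear T by (fact T)
  have "\<exists>s. \<forall>x. inner (T x) y = inner x s" for y
  proof -
    have "bounded_linear (\<lambda>x. inner (T x) y)"
      by (rule bounded_linear_compose[OF bounded_linear_inner_left T])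
    then show ?thesis by (rule riesz_representation) blast
  qed
  then obtain S where S: "\<And>x y. inner (T x) y = inner x (S y)"
    by metis
  obtain K where K: "K \<ge> 0" "\<And>x. norm (T x) \<le> norm x * K"
    using T.nonneg_bounded by blast
  have "bounded_linear S"
  proof (rule bounded_linear_intro)
    show "S (x + y) = S x + S y" for x y
      by (rule inner_ext) (simp add: inner_add_right flip: S)
    show "S (r *\<^sub>R x) = r *\<^sub>R S x" for r x
      by (rule inner_ext) (simp flip: S)
    show "norm (S y) \<le> norm y * K" for y
    proof (cases "S y = 0")
      case True
      with K show ?thesis by simp
    next
      case False
      have "norm (S y) * norm (S y) = inner (T (S y)) y"
        by (simp add: S flip: power2_eq_square power2_norm_eq_inner)
      also have "\<dots> \<le> norm (T (S y)) * norm y"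
        by (rule norm_cauchy_schwarz)
      also have "\<dots> \<le> norm (S y) * K * norm y"
        by (intro mult_right_mono K) simp
      finally show ?thesis
        using False by (simp add: mult.assoc mult.commute)
    qed
  qed
  then show ?thesis using S by (rule that)
qed

subsection \<open>Square roots of positive semidefinite operators\<close>

text \<open>Symmetry is a separate clause because over the reals it does not follow from
  nonnegativity of the quadratic form.\<close>

definition psd_op :: "('a::real_inner \<Rightarrow> 'a) \<Rightarrow> bool" where
  "psd_op A \<longleftrightarrow> bounded_linear A \<and> (\<forall>x y. inner (A x) y = inner x (A y)) \<and>
    (\<forall>x. 0 \<le> inner (A x) x)"

lemma psd_opD:
  assumes "psd_op A"
  shows "bounded_linear A" "inner (A x) y = inner x (A y)" "0 \<le> inner (A x) x"
  using assms unfolding psd_op_def by blast+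

lemma psd_op_Cauchy_Schwarz:
  assumes "psd_op A"
  shows "(inner (A x) y)\<^sup>2 \<le> inner (A x) x * inner (A y) y"
proof (rule nonneg_quadratic_discriminant)
  interpret A: bounded_linear A using assms by (simp add: psd_op_def)
  have sym: "\<And>x y. inner (A x) y = inner x (A y)" and pos: "\<And>x. 0 \<le> inner (A x) x"
    using psd_opD[OF assms] by blast+
  show "0 \<le> inner (A y) y" by (rule pos)
  fix t
  have "inner (A y) x = inner (A x) y"
    by (metis sym inner_commute)
  then show "0 \<le> inner (A x) x - 2 * t * inner (A x) y + t\<^sup>2 * inner (A y) y"
    using pos[of "x - t *\<^sub>R y"]
    by (simp add: A.diff A.scaleR inner_diff_left inner_diff_right power2_eq_square algebra_simps)
qed

text \<open>Cauchy-Schwarz against the vector \<open>A x\<close> bounds the fourth power of its norm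
  by 0.\<close>

lemma psd_op_inner_eq_0_imp:
  assumes "psd_op A" "inner (A x) x = 0"
  shows "A x = 0"
  using psd_op_Cauchy_Schwarz[OF assms(1), of x "A x"] assms(2) by simp

text \<open>With \<open>K = 1 - A\<close>, a solution \<open>L\<close> of
  \<open>L = (K + L\<^sup>2) / 2\<close> gives \<open>(1 - L)\<^sup>2 = 1 - K = A\<close>, so
  \<open>B = 1 - L\<close>. The commutation clause is what later yields uniqueness of the root and
  its complex linearity.\<close>

lemma psd_contraction_sqrt_exists:
  fixes A :: "'a::{real_inner, banach} \<Rightarrow> 'a"
  assumes A: "psd_op A" and contr: "\<And>x. norm (A x) \<le> norm x"
  obtains B where "psd_op B" "B \<circ> B = A"
    "\<And>C. bounded_linear C \<Longrightarrow> C \<circ> A = A \<circ> C \<Longrightarrow> C \<circ> B = B \<circ> C"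
proof -
  interpret A: bounded_linear A using A by (simp add: psd_op_def)
  have sym: "\<And>x y. inner (A x) y = inner x (A y)" and pos: "\<And>x. 0 \<le> inner (A x) x"
    using psd_opD[OF A] by blast+
  define K :: "'a \<Rightarrow>\<^sub>L 'a" where "K = Blinfun (\<lambda>x. x - A x)"
  have K: "blinfun_apply K x = x - A x" for x
    unfolding K_def
    by (subst bounded_linear_Blinfun_apply)
      (auto intro!: bounded_linear_sub bounded_linear_ident A.bounded_linear_axioms)
  \<comment> \<open>Cauchy-Schwarz against \<open>A x\<close>, with the contraction bound on the
    second factor. It makes \<open>norm (x - A x)\<close> at most \<open>norm x\<close>.\<close>
  have normA: "(norm (A x))\<^sup>2 \<le> inner (A x) x" for x
  proof (cases "A x = 0")
    case False
    have "((norm (A x))\<^sup>2)\<^sup>2 \<le> inner (A x) x * inner (A (A x)) (A x)"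
      using psd_op_Cauchy_Schwarz[OF A, of x "A x"] by (simp add: power2_norm_eq_inner)
    also have "inner (A (A x)) (A x) \<le> norm (A (A x)) * norm (A x)"
      by (rule norm_cauchy_schwarz)
    also have "\<dots> \<le> (norm (A x))\<^sup>2"
      using contr[of "A x"] by (simp add: power2_eq_square mult_right_mono)
    finally have "((norm (A x))\<^sup>2)\<^sup>2 \<le> inner (A x) x * (norm (A x))\<^sup>2"
      using pos[of x] by (simp add: mult_left_mono)
    with False show ?thesis by (simp add: power2_eq_square)
  qed simp
  have normK: "norm K \<le> 1"
  proof (rule norm_blinfun_bound)
    fix x
    have "(norm (x - A x))\<^sup>2 \<le> (norm x)\<^sup>2"
      using normA[of x] pos[of x]
      by (simp add: power2_norm_eq_inner inner_diff_left inner_diff_right inner_commute)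
    then show "norm (blinfun_apply K x) \<le> 1 * norm x"
      by (simp add: K)
  qed simp
  \<comment> \<open>\<open>Y\<close> tends to the fixed point \<open>1 - sqrt (1 - K)\<close> of \<open>Z = (K + Z\<^sup>2) / 2\<close>; since \<open>norm K \<le> 1\<close>, its
    increments are dominated by those of the same scalar iteration with \<open>K = 1\<close>.\<close>
  define Y :: "nat \<Rightarrow> 'a \<Rightarrow>\<^sub>L 'a" where
    "Y = rec_nat 0 (\<lambda>_ Z. (1/2) *\<^sub>R (K + (Z o\<^sub>L Z)))"
  define y :: "nat \<Rightarrow> real" where "y = rec_nat 0 (\<lambda>_ z. (1 + z * z) / 2)"
  have Y0: "Y 0 = 0" and YS: "\<And>n. Y (Suc n) = (1/2) *\<^sub>R (K + (Y n o\<^sub>L Y n))"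
    by (simp_all add: Y_def)
  have y0: "y 0 = 0" and yS: "\<And>n. y (Suc n) = (1 + y n * y n) / 2"
    by (simp_all add: y_def)
  have ybd: "0 \<le> y n \<and> y n \<le> 1" for n
  proof (induction n)
    case (Suc n)
    then have "y n * y n \<le> 1 * 1" by (intro mult_mono) auto
    then show ?case by (simp add: yS)
  qed (simp add: y0)
  have yinc: "incseq y"
  proof (rule incseq_SucI)
    fix n
    have "0 \<le> (1 - y n) * (1 - y n)" by simp
    then show "y n \<le> y (Suc n)" by (simp add: yS algebra_simps)
  qed
  have Ybd: "norm (Y n) \<le> y n" for n
  proof (induction n)
    case (Suc n)
    have "norm (Y n o\<^sub>L Y n) \<le> norm (Y n) * norm (Y n)" by (rule norm_blinfun_compose)
    also have "\<dots> \<le> y n * y n" using Suc ybd by (intro mult_mono) auto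
    finally show ?case
      using normK norm_triangle_ineq[of K "Y n o\<^sub>L Y n"] by (simp add: YS yS)
  qed (simp add: Y0 y0)
  have Ystep: "norm (Y (Suc n) - Y n) \<le> y (Suc n) - y n" for n
  proof (induction n)
    case 0
    show ?case using normK by (simp add: YS yS Y0 y0)
  next
    case (Suc n)
    let ?D = "Y (Suc n) - Y n"
    \<comment> \<open>The noncommutative difference of squares
      \<open>Y\<^sup>2 - Z\<^sup>2 = Y (Y - Z) + (Y - Z) Z\<close>; the scalar sequence satisfies
      the same identity with equality of the bounds.\<close>
    have "Y (Suc (Suc n)) - Y (Suc n)
        = (1/2) *\<^sub>R ((Y (Suc n) o\<^sub>L ?D) + (?D o\<^sub>L Y n))"
      unfolding YS[of "Suc n"] YS[of n]
      by (rule blinfun_eqI) (simp add: blinfun.bilinear_simps algebra_simps)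
    also have "norm \<dots> \<le> (norm (Y (Suc n)) * norm ?D + norm ?D * norm (Y n)) / 2"
      using norm_triangle_ineq[of "Y (Suc n) o\<^sub>L ?D" "?D o\<^sub>L Y n"]
        norm_blinfun_compose[of "Y (Suc n)" ?D] norm_blinfun_compose[of ?D "Y n"]
      by simp
    also have "\<dots> \<le> (y (Suc n) * (y (Suc n) - y n) + (y (Suc n) - y n) * y n) / 2"
      using Suc Ybd[of n] Ybd[of "Suc n"] ybd[of n] ybd[of "Suc n"] incseq_SucD[OF yinc, of n]
      by (intro divide_right_mono add_mono mult_mono) (auto intro: order_trans[OF norm_ge_zero])
    also have "\<dots> = y (Suc (Suc n)) - y (Suc n)"
      unfolding yS[of "Suc n"] by (subst (5) yS) (simp add: field_simps)
    finally show ?case .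
  qed
  have dist: "norm (Y m - Y n) \<le> y m - y n" if "n \<le> m" for m n
    using that
  proof (induction m rule: dec_induct)
    case (step m)
    have "norm (Y (Suc m) - Y n) \<le> norm (Y (Suc m) - Y m) + norm (Y m - Y n)"
      using norm_triangle_ineq[of "Y (Suc m) - Y m" "Y m - Y n"] by simp
    with step.IH Ystep[of m] show ?case by simp
  qed simp
  have "convergent y"
    using incseq_convergent[OF yinc, of 1] ybd by (metis convergentI)
  then have "Cauchy y" by (rule convergent_Cauchy)
  have "Cauchy Y"
  proof (rule CauchyI)
    fix e :: real assume "e > 0"
    with \<open>Cauchy y\<close> obtain M where M: "\<And>m n. m \<ge> M \<Longrightarrow> n \<ge> M \<Longrightarrow> norm (y m - y n) < e"
      by (meson CauchyD)
    have "norm (Y m - Y n) < e" if "m \<ge> M" "n \<ge> M" for m n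
    proof (cases "n \<le> m")
      case True
      with dist[of n m] M[OF that] show ?thesis by simp
    next
      case False
      with dist[of m n] M[OF that] show ?thesis by (simp add: norm_minus_commute)
    qed
    then show "\<exists>M. \<forall>m\<ge>M. \<forall>n\<ge>M. norm (Y m - Y n) < e" by blast
  qed
  then obtain L where L: "Y \<longlonglongrightarrow> L"
    using Cauchy_convergent_iff convergent_def by blast
  have Lx: "(\<lambda>n. blinfun_apply (Y n) x) \<longlonglongrightarrow> blinfun_apply L x" for x
    by (intro tendsto_intros L)
  have "(\<lambda>n. (1/2) *\<^sub>R (K + (Y n o\<^sub>L Y n))) \<longlonglongrightarrow> (1/2) *\<^sub>R (K + (L o\<^sub>L L))"
    by (intro tendsto_intros L)
  moreover have "(\<lambda>n. (1/2) *\<^sub>R (K + (Y n o\<^sub>L Y n))) \<longlonglongrightarrow> L"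
    using LIMSEQ_Suc[OF L] by (simp add: YS)
  ultimately have Leq: "(1/2) *\<^sub>R (K + (L o\<^sub>L L)) = L"
    by (rule LIMSEQ_unique)
  have normL: "norm L \<le> 1"
    by (rule LIMSEQ_le_const2[OF tendsto_norm[OF L]]) (meson Ybd ybd order_trans)
  have Ysym: "inner (Y n x) z = inner x (Y n z)" for n x z
  proof (induction n arbitrary: x z)
    case (Suc n)
    show ?case
      by (simp add: YS blinfun.bilinear_simps K Suc inner_add_left inner_add_right
          inner_diff_left inner_diff_right sym)
  qed (simp add: Y0)
  have Lsym: "inner (L x) z = inner x (L z)" for x z
  proof (rule LIMSEQ_unique)
    show "(\<lambda>n. inner (Y n x) z) \<longlonglongrightarrow> inner (L x) z" by (intro tendsto_intros Lx)
    show "(\<lambda>n. inner (Y n x) z) \<longlonglongrightarrow> inner x (L z)"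
      unfolding Ysym by (intro tendsto_intros Lx)
  qed
  define B where "B = (\<lambda>x. x - L x)"
  have "psd_op B"
    unfolding psd_op_def
  proof (intro conjI allI)
    show "bounded_linear B"
      unfolding B_def by (intro bounded_linear_sub bounded_linear_ident blinfun.bounded_linear_right)
    show "inner (B x) z = inner x (B z)" for x z
      by (simp add: B_def Lsym inner_diff_left inner_diff_right)
    show "0 \<le> inner (B x) x" for x
    proof -
      have "inner (L x) x \<le> norm (L x) * norm x" by (rule norm_cauchy_schwarz)
      also have "\<dots> \<le> (norm L * norm x) * norm x"
        by (intro mult_right_mono norm_blinfun) simp
      also have "\<dots> \<le> (1 * norm x) * norm x"
        by (intro mult_right_mono normL) simp_all
      finally show ?thesis
        by (simp add: B_def inner_diff_left power2_norm_eq_inner flip: power2_eq_square)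
    qed
  qed
  moreover have "B \<circ> B = A"
  proof
    fix x
    have "(1/2) *\<^sub>R ((x - A x) + L (L x)) = L x"
      using arg_cong[OF Leq, of "\<lambda>Z. blinfun_apply Z x"]
      by (simp add: blinfun.bilinear_simps K)
    then have "2 *\<^sub>R ((1/2) *\<^sub>R ((x - A x) + L (L x))) = 2 *\<^sub>R L x" by simp
    then have "x - A x + L (L x) = L x + L x" by (simp add: scaleR_2)
    then have "A x = x + L (L x) - (L x + L x)" by (simp add: algebra_simps)
    then show "(B \<circ> B) x = A x"
      by (simp add: B_def blinfun.diff_right)
  qed
  moreover have "C \<circ> B = B \<circ> C" if C: "bounded_linear C" and comm: "C \<circ> A = A \<circ> C" for C
  proof -
    interpret C: bounded_linear C by (fact C)
    have CA: "C (A x) = A (C x)" for x using comm by (metis comp_apply)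
    \<comment> \<open>Each iterate is a polynomial in \<open>A\<close>, so it commutes with
      \<open>C\<close>; continuity of \<open>C\<close> carries this to the limit
      \<open>L\<close>.\<close>
    have "C (Y n x) = Y n (C x)" for n x
      by (induction n arbitrary: x)
        (simp_all add: Y0 YS K blinfun.bilinear_simps C.zero C.add C.diff C.scaleR CA)
    then have "(\<lambda>n. Y n (C x)) \<longlonglongrightarrow> C (L x)" for x
      using C.tendsto[OF Lx[of x]] by simp
    then have "C (L x) = L (C x)" for x
      using LIMSEQ_unique Lx by blast
    then show ?thesis by (auto simp: B_def C.diff)
  qed
  ultimately show ?thesis by (rule that)
qed

text \<open>Dividing by a bound \<open>M\<close> reduces to a contraction, and the root is
  multiplied by \<open>sqrt M\<close> afterwards.\<close>

lemma psd_sqrt_exists: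
  fixes A :: "'a::{real_inner, banach} \<Rightarrow> 'a"
  assumes A: "psd_op A"
  obtains B where "psd_op B" "B \<circ> B = A"
    "\<And>C. bounded_linear C \<Longrightarrow> C \<circ> A = A \<circ> C \<Longrightarrow> C \<circ> B = B \<circ> C"
proof -
  interpret A: bounded_linear A using A by (simp add: psd_op_def)
  obtain M where M: "M > 0" "\<And>x. norm (A x) \<le> norm x * M"
    using A.pos_bounded by blast
  define A' where "A' = (\<lambda>x. (1 / M) *\<^sub>R A x)"
  have "psd_op A'"
    using A M(1) by (auto simp: psd_op_def A'_def intro: bounded_linear_const_scaleR)
  moreover have "norm (A' x) \<le> norm x" for x
    using M by (simp add: A'_def field_simps)
  ultimately obtain B where B: "psd_op B" "B \<circ> B = A'"
    and comm: "\<And>C. bounded_linear C \<Longrightarrow> C \<circ> A' = A' \<circ> C \<Longrightarrow> C \<circ> B = B \<circ> C"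
    by (rule psd_contraction_sqrt_exists) blast
  interpret B: bounded_linear B using B by (simp add: psd_op_def)
  show ?thesis
  proof
    show "psd_op (\<lambda>x. sqrt M *\<^sub>R B x)"
      using B(1) M(1) by (auto simp: psd_op_def intro: bounded_linear_const_scaleR)
    have "B (B x) = (1 / M) *\<^sub>R A x" for x
      using fun_cong[OF B(2), of x] by (simp add: A'_def)
    then show "(\<lambda>x. sqrt M *\<^sub>R B x) \<circ> (\<lambda>x. sqrt M *\<^sub>R B x) = A"
      using M(1) by (auto simp: B.scaleR)
    fix C :: "'a \<Rightarrow> 'a"
    assume C: "bounded_linear C" and CA: "C \<circ> A = A \<circ> C"
    interpret C: bounded_linear C by (fact C)
    have "C \<circ> A' = A' \<circ> C"
      using CA by (auto simp: A'_def fun_eq_iff C.scaleR)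
    from comm[OF C this] show "C \<circ> (\<lambda>x. sqrt M *\<^sub>R B x) = (\<lambda>x. sqrt M *\<^sub>R B x) \<circ> C"
      by (auto simp: fun_eq_iff C.scaleR)
  qed
qed

text \<open>For \<open>y = B x - C x\<close> commutation gives
  \<open>(B + C) y = B\<^sup>2 x - C\<^sup>2 x = 0\<close>. Both forms are nonnegative, so
  \<open>B y = C y = 0\<close>, and symmetry turns \<open>inner y y\<close> into
  \<open>inner x (B y - C y) = 0\<close>.\<close>

lemma psd_sqrt_commuting_unique:
  fixes B C :: "'a::real_inner \<Rightarrow> 'a"
  assumes B: "psd_op B" and C: "psd_op C" and sq: "B \<circ> B = C \<circ> C" and comm: "C \<circ> B = B \<circ> C"
  shows "B = C"
proof
  fix x
  interpret B: bounded_linear B using B by (simp add: psd_op_def)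
  interpret C: bounded_linear C using C by (simp add: psd_op_def)
  define y where "y = B x - C x"
  have "B y + C y = 0"
    using fun_cong[OF sq, of x] fun_cong[OF comm, of x] by (simp add: y_def B.diff C.diff)
  then have "inner (B y) y + inner (C y) y = 0"
    by (simp flip: inner_add_left)
  moreover have "inner (B y) y \<ge> 0" "inner (C y) y \<ge> 0"
    using psd_opD(3)[OF B] psd_opD(3)[OF C] by blast+
  ultimately have "B y = 0" "C y = 0"
    using psd_op_inner_eq_0_imp[OF B, of y] psd_op_inner_eq_0_imp[OF C, of y] by linarith+
  moreover have "inner y y = inner x (B y) - inner x (C y)"
    unfolding psd_opD(2)[OF B, symmetric] psd_opD(2)[OF C, symmetric]
    by (simp add: y_def inner_diff_left)
  ultimately have "inner y y = 0" by simp
  then show "B x = C x" by (simp add: y_def)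
qed

text \<open>The constructed root \<open>D\<close> commutes with everything that commutes with the
  common square, in particular with \<open>B\<close> and \<open>C\<close>. Hence each of them equals
  \<open>D\<close>.\<close>

lemma psd_sqrt_unique:
  fixes B C :: "'a::{real_inner, banach} \<Rightarrow> 'a"
  assumes B: "psd_op B" and C: "psd_op C" and sq: "B \<circ> B = C \<circ> C"
  shows "B = C"
proof -
  have BB: "psd_op (B \<circ> B)"
    using B unfolding psd_op_def
    by (auto simp: o_def intro: bounded_linear_compose) (metis inner_ge_zero)
  obtain D where D: "psd_op D" "D \<circ> D = B \<circ> B"
    and comm: "\<And>E. bounded_linear E \<Longrightarrow> E \<circ> (B \<circ> B) = (B \<circ> B) \<circ> E \<Longrightarrow> E \<circ> D = D \<circ> E"
    using psd_sqrt_exists[OF BB] by blast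
  have "B \<circ> D = D \<circ> B"
    using B by (intro comm) (auto simp: psd_op_def o_assoc)
  moreover have "C \<circ> D = D \<circ> C"
    using C by (intro comm) (auto simp: psd_op_def o_assoc sq)
  ultimately have "D = B" "D = C"
    using psd_sqrt_commuting_unique[OF D(1) B] psd_sqrt_commuting_unique[OF D(1) C] D(2) sq by auto
  then show ?thesis by simp
qed

subsection \<open>Complex structure\<close>

instance chilbert_space \<subseteq> banach ..

text \<open>The second argument is conjugate linear, so multiplying it by \<open>\<i>\<close>
  multiplies the value by \<open>-\<i>\<close>. Thus the real inner product determines the complex
  one.\<close>

lemma Im_cinner: "Im (cinner x y) = inner x (\<i> *\<^sub>C y)"
proof -
  have "cinner x (\<i> *\<^sub>C y) = cnj (cinner (\<i> *\<^sub>C y) x)" by (rule cinner_commute)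
  also have "\<dots> = cnj (\<i> * cinner y x)" by (simp add: cinner_scaleC_left)
  also have "\<dots> = - \<i> * cinner x y" by (simp flip: cinner_commute[of x y])
  finally show ?thesis by (simp add: inner_eq_Re_cinner)
qed

lemma inner_scaleC_i_left: "inner (\<i> *\<^sub>C x) y = - inner (x :: 'a::chilbert_space) (\<i> *\<^sub>C y)"
  using Im_cinner[of x y] by (simp add: inner_eq_Re_cinner cinner_scaleC_left)

lemma scaleC_i_i: "\<i> *\<^sub>C \<i> *\<^sub>C x = - x"
proof -
  have "\<i> *\<^sub>C \<i> *\<^sub>C x = complex_of_real (-1) *\<^sub>C x" by (simp add: scaleC_scaleC)
  also have "\<dots> = (-1) *\<^sub>R x" by (rule scaleR_scaleC[symmetric])
  finally show ?thesis by simp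
qed

lemma scaleC_eq_scaleR: "a *\<^sub>C x = Re a *\<^sub>R x + Im a *\<^sub>R (\<i> *\<^sub>C x)"
  unfolding scaleR_scaleC scaleC_scaleC scaleC_add_left[symmetric]
  by (simp add: complex_eq mult.commute)

lemma norm_scaleC_i: "norm (\<i> *\<^sub>C x) = norm (x :: 'a::chilbert_space)"
  by (simp add: norm_eq_sqrt_inner inner_scaleC_i_left scaleC_i_i)

lemma bounded_linear_scaleC_i: "bounded_linear (\<lambda>x::'a::chilbert_space. \<i> *\<^sub>C x)"
proof (rule bounded_linear_intro)
  show "\<i> *\<^sub>C r *\<^sub>R x = r *\<^sub>R \<i> *\<^sub>C x" for r and x :: 'a
    by (simp add: scaleR_scaleC scaleC_scaleC mult.commute)
  show "norm (\<i> *\<^sub>C x) \<le> norm x * 1" for x :: 'a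
    by (simp add: norm_scaleC_i)
qed (rule scaleC_add_right)

text \<open>Every complex scalar is a real combination of 1 and \<open>\<i>\<close>, so a real
  linear map only has to commute with \<open>\<i>\<close>.\<close>

lemma bounded_clinear_iff:
  "bounded_clinear T \<longleftrightarrow> bounded_linear T \<and> (\<forall>x. T (\<i> *\<^sub>C x) = \<i> *\<^sub>C T x)"
proof
  assume *: "bounded_linear T \<and> (\<forall>x. T (\<i> *\<^sub>C x) = \<i> *\<^sub>C T x)"
  then interpret T: bounded_linear T by simp
  have "T (a *\<^sub>C x) = a *\<^sub>C T x" for a x
    unfolding scaleC_eq_scaleR[of a] using * by (simp add: T.add T.scaleR)
  with * show "bounded_clinear T" by (simp add: bounded_clinear_def)
qed (simp add: bounded_clinear_def)

lemma bounded_clinear_bounded_linear: "bounded_clinear T \<Longrightarrow> bounded_linear T"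
  by (simp add: bounded_clinear_def)

text \<open>The real adjoint already works: multiplication by \<open>\<i>\<close> is skew for the
  real inner product, so the adjoint commutes with \<open>\<i>\<close> whenever \<open>T\<close>
  does.\<close>

lemma cadjoint_exists:
  fixes T :: "'a::chilbert_space \<Rightarrow> 'b::chilbert_space"
  assumes T: "bounded_clinear T"
  shows "\<exists>S. bounded_clinear S \<and> (\<forall>x y. cinner (T x) y = cinner x (S y))"
proof -
  obtain S where S: "bounded_linear S" and adj: "\<And>x y. inner (T x) y = inner x (S y)"
    using adjoint_exists[OF bounded_clinear_bounded_linear[OF T]] by blast
  have Ti: "T (\<i> *\<^sub>C x) = \<i> *\<^sub>C T x" for x
    using T by (simp add: bounded_clinear_def)
  have Si: "S (\<i> *\<^sub>C y) = \<i> *\<^sub>C S y" for y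
  proof (rule inner_ext)
    fix x
    have "inner x (S (\<i> *\<^sub>C y)) = inner (T x) (\<i> *\<^sub>C y)" by (rule adj[symmetric])
    also have "\<dots> = - inner (T (\<i> *\<^sub>C x)) y" by (simp add: inner_scaleC_i_left Ti)
    also have "\<dots> = inner x (\<i> *\<^sub>C S y)" by (simp add: inner_scaleC_i_left adj)
    finally show "inner x (S (\<i> *\<^sub>C y)) = inner x (\<i> *\<^sub>C S y)" .
  qed
  show ?thesis
  proof (intro exI[of _ S] conjI allI)
    show "bounded_clinear S" using S Si by (simp add: bounded_clinear_iff)
    show "cinner (T x) y = cinner x (S y)" for x y
    proof (rule complex_eqI)
      show "Re (cinner (T x) y) = Re (cinner x (S y))"
        using adj by (simp flip: inner_eq_Re_cinner)
      show "Im (cinner (T x) y) = Im (cinner x (S y))"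
        by (simp add: Im_cinner adj Si)
    qed
  qed
qed

lemma cadjoint_props:
  fixes T :: "'a::chilbert_space \<Rightarrow> 'b::chilbert_space"
  assumes "bounded_clinear T"
  shows bounded_clinear_cadjoint: "bounded_clinear (cadjoint T)"
    and inner_cadjoint: "inner (T x) y = inner x (cadjoint T y)"
proof -
  have "\<exists>!S. bounded_clinear S \<and> (\<forall>x y. cinner (T x) y = cinner x (S y))"
  proof (rule ex_ex1I)
    show "\<exists>S. bounded_clinear S \<and> (\<forall>x y. cinner (T x) y = cinner x (S y))"
      by (rule cadjoint_exists[OF assms])
  next
    fix S S'
    assume S: "bounded_clinear S \<and> (\<forall>x y. cinner (T x) y = cinner x (S y))"
      and S': "bounded_clinear S' \<and> (\<forall>x y. cinner (T x) y = cinner x (S' y))"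
    show "S = S'"
    proof (rule ext, rule inner_ext)
      fix y x
      have "cinner (T x) y = cinner x (S y)" using S by blast
      moreover have "cinner (T x) y = cinner x (S' y)" using S' by blast
      ultimately show "inner x (S y) = inner x (S' y)"
        unfolding inner_eq_Re_cinner by simp
    qed
  qed
  from theI'[OF this]
  have *: "bounded_clinear (cadjoint T) \<and> (\<forall>x y. cinner (T x) y = cinner x (cadjoint T y))"
    unfolding cadjoint_def .
  then show "bounded_clinear (cadjoint T)" "inner (T x) y = inner x (cadjoint T y)"
    by (simp_all add: inner_eq_Re_cinner)
qed

text \<open>Complex positivity includes that the form is real valued, and polarising this yields
  symmetry. It allows the real square root theory to be applied.\<close>

lemma positive_op_iff:
  fixes A :: "'a::chilbert_space \<Rightarrow> 'a"
  shows "positive_op A \<longleftrightarrow> psd_op A \<and> (\<forall>x. A (\<i> *\<^sub>C x) = \<i> *\<^sub>C A x)"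
proof
  assume A: "positive_op A"
  then have lin: "bounded_linear A" and Ai: "\<And>x. A (\<i> *\<^sub>C x) = \<i> *\<^sub>C A x"
    and c: "\<And>x. cinner (A x) x \<in> \<real>\<^sub>\<ge>\<^sub>0"
    by (auto simp: positive_op_def bounded_clinear_iff)
  interpret A: bounded_linear A by (fact lin)
  have im: "inner (A z) (\<i> *\<^sub>C z) = 0" for z
    using c[of z] by (simp add: complex_nonneg_Reals_iff flip: Im_cinner)
  \<comment> \<open>The quadratic form \<open>inner (A z) (\<i> *\<^sub>C z)\<close> vanishes
    identically, hence so does its polarisation. Replacing \<open>y\<close> by
    \<open>\<i> *\<^sub>C y\<close> then gives symmetry.\<close>
  have alt: "inner (A x) (\<i> *\<^sub>C y) + inner (A y) (\<i> *\<^sub>C x) = 0" for x y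
    using im[of "x + y"] im[of x] im[of y]
    by (simp add: A.add scaleC_add_right inner_add_left inner_add_right)
  have "inner (A x) y = inner x (A y)" for x y
    using alt[of x "\<i> *\<^sub>C y"]
    by (simp add: scaleC_i_i Ai inner_scaleC_i_left inner_commute[of x])
  moreover have "0 \<le> inner (A x) x" for x
    using c[of x] by (simp add: complex_nonneg_Reals_iff inner_eq_Re_cinner)
  ultimately show "psd_op A \<and> (\<forall>x. A (\<i> *\<^sub>C x) = \<i> *\<^sub>C A x)"
    using lin Ai by (simp add: psd_op_def)
next
  assume A: "psd_op A \<and> (\<forall>x. A (\<i> *\<^sub>C x) = \<i> *\<^sub>C A x)"
  then have psd: "psd_op A" by simp
  have "Im (cinner (A x) x) = 0" for x
  proof -
    have "inner (A x) (\<i> *\<^sub>C x) = inner x (\<i> *\<^sub>C A x)"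
      using A psd_opD(2)[OF psd] by simp
    also have "\<dots> = - inner (A x) (\<i> *\<^sub>C x)"
      by (subst inner_commute) (simp add: inner_scaleC_i_left)
    finally show ?thesis by (simp add: Im_cinner)
  qed
  then show "positive_op A"
    using A psd_opD(1,3)[OF psd]
    by (simp add: positive_op_def bounded_clinear_iff complex_nonneg_Reals_iff flip: inner_eq_Re_cinner)
qed

lemma positive_op_sqrt:
  fixes A :: "'a::chilbert_space \<Rightarrow> 'a"
  assumes "positive_op A"
  shows "positive_op (op_sqrt A)" "op_sqrt A \<circ> op_sqrt A = A"
proof -
  have psd: "psd_op A" and Ai: "\<And>x. A (\<i> *\<^sub>C x) = \<i> *\<^sub>C A x"
    using assms by (auto simp: positive_op_iff)
  obtain B where B: "psd_op B" "B \<circ> B = A"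
    and comm: "\<And>C. bounded_linear C \<Longrightarrow> C \<circ> A = A \<circ> C \<Longrightarrow> C \<circ> B = B \<circ> C"
    using psd_sqrt_exists[OF psd] by blast
  \<comment> \<open>Complex linearity of the real root: multiplication by \<open>\<i>\<close> is a
    bounded real linear map commuting with \<open>A\<close>.\<close>
  have "(\<lambda>x. \<i> *\<^sub>C x) \<circ> B = B \<circ> (\<lambda>x. \<i> *\<^sub>C x)"
    by (rule comm[OF bounded_linear_scaleC_i]) (simp add: fun_eq_iff Ai)
  then have "positive_op B"
    using B(1) by (simp add: positive_op_iff fun_eq_iff)
  then have "\<exists>!B. positive_op B \<and> B \<circ> B = A"
    using B(2) psd_sqrt_unique by (intro ex1I[of _ B]) (auto simp: positive_op_iff)
  from theI'[OF this] show "positive_op (op_sqrt A)" "op_sqrt A \<circ> op_sqrt A = A"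
    unfolding op_sqrt_def by blast+
qed

subsection \<open>The joint polar decomposition\<close>

text \<open>The operator under the root has the form \<open>\<langle>T\<^sub>1 x, T\<^sub>1
  y\<rangle> + \<langle>T\<^sub>2 x, T\<^sub>2 y\<rangle>\<close>, which is positive and on the
  diagonal is the squared norm of the column.\<close>

lemma joint_modulus_props:
  fixes T :: "('a::chilbert_space \<Rightarrow> 'a) \<times> ('a \<Rightarrow> 'a)"
  assumes "bounded_clinear (fst T)" "bounded_clinear (snd T)"
  shows positive_joint_modulus: "positive_op (joint_modulus T)"
    and norm_joint_modulus: "norm (joint_modulus T x) = norm (column T x)"
proof -
  define A where "A = (\<lambda>x. cadjoint (fst T) (fst T x) + cadjoint (snd T) (snd T x))"
  note adj = inner_cadjoint[OF assms(1)] inner_cadjoint[OF assms(2)]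
  note clin = assms bounded_clinear_cadjoint[OF assms(1)] bounded_clinear_cadjoint[OF assms(2)]
  have form: "inner (A x) y = inner (fst T x) (fst T y) + inner (snd T x) (snd T y)" for x y
  proof -
    have "inner y (A x) = inner (fst T y) (fst T x) + inner (snd T y) (snd T x)"
      by (simp add: A_def inner_add_right adj)
    then show ?thesis
      unfolding inner_commute[of "A x" y] inner_commute[of "fst T x"] inner_commute[of "snd T x"] .
  qed
  have "positive_op A"
    unfolding positive_op_iff psd_op_def
  proof (intro conjI allI)
    show "bounded_linear A"
      unfolding A_def
      using bounded_linear_add[OF
          bounded_linear_compose[OF clin(3,1)[THEN bounded_clinear_bounded_linear]]
          bounded_linear_compose[OF clin(4,2)[THEN bounded_clinear_bounded_linear]]] .
    show "inner (A x) y = inner x (A y)" for x y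
      unfolding inner_commute[of x "A y"] form by (simp add: inner_commute)
    show "0 \<le> inner (A x) x" for x by (simp add: form)
    show "A (\<i> *\<^sub>C x) = \<i> *\<^sub>C A x" for x
      using clin by (simp add: A_def bounded_clinear_def scaleC_add_right)
  qed
  from positive_op_sqrt[OF this]
  have P: "positive_op (joint_modulus T)" and sq: "joint_modulus T \<circ> joint_modulus T = A"
    unfolding joint_modulus_def A_def by blast+
  show "positive_op (joint_modulus T)" by (fact P)
  have psd: "psd_op (joint_modulus T)" using P by (simp add: positive_op_iff)
  have "inner (joint_modulus T x) (joint_modulus T x) = inner (column T x) (column T x)"
    using psd_opD(2)[OF psd, of "joint_modulus T x" x] fun_cong[OF sq, of x] form[of x x]
    by (simp add: column_def inner_prod_def)
  then show "norm (joint_modulus T x) = norm (column T x)"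
    by (simp add: norm_eq_sqrt_inner)
qed

section \<open>Closures of ranges and the orthogonal splitting for a semidefinite operator\<close>

lemma subspace_closure:
  fixes S :: "'a::real_normed_vector set"
  assumes "subspace S"
  shows "subspace (closure S)"
proof (rule subspaceI)
  show "0 \<in> closure S"
    using subspace_0[OF assms] by (rule closure_subset[THEN subsetD])
  show "x + y \<in> closure S" if xy: "x \<in> closure S" "y \<in> closure S" for x y
  proof -
    obtain f g where "\<And>n. f n \<in> S" "f \<longlonglongrightarrow> x" "\<And>n. g n \<in> S" "g \<longlonglongrightarrow> y"
      using xy unfolding closure_sequential by metis
    then have "\<forall>n. f n + g n \<in> S" "(\<lambda>n. f n + g n) \<longlonglongrightarrow> x + y"
      using assms by (auto intro: subspace_add tendsto_add)
    then show ?thesis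
      unfolding closure_sequential by (intro exI[of _ "\<lambda>n. f n + g n"] conjI)
  qed
  show "c *\<^sub>R x \<in> closure S" if x: "x \<in> closure S" for c x
  proof -
    obtain f where "\<And>n. f n \<in> S" "f \<longlonglongrightarrow> x"
      using x unfolding closure_sequential by metis
    then have "\<forall>n. c *\<^sub>R f n \<in> S" "(\<lambda>n. c *\<^sub>R f n) \<longlonglongrightarrow> c *\<^sub>R x"
      using assms by (auto intro: subspace_scale tendsto_scaleR)
    then show ?thesis
      unfolding closure_sequential by (intro exI[of _ "\<lambda>n. c *\<^sub>R f n"] conjI)
  qed
qed

lemma closure_rangeE:
  fixes P :: "'a \<Rightarrow> 'b::metric_space"
  assumes "u \<in> closure (range P)"
  obtains w where "(\<lambda>n. P (w n)) \<longlonglongrightarrow> u"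
proof -
  obtain f where "\<forall>n. f n \<in> range P" and f: "f \<longlonglongrightarrow> u"
    using assms unfolding closure_sequential by blast
  then have "\<forall>n. \<exists>z. f n = P z" by blast
  from choice[OF this] obtain w where "\<forall>n. f n = P (w n)" ..
  then have "f = (\<lambda>n. P (w n))" by (intro ext) simp
  with f that show ?thesis by simp
qed

text \<open>The residual \<open>k\<close> of the projection is orthogonal to \<open>P (P k)\<close>,
  and by symmetry this says that \<open>P k\<close> has norm 0.\<close>

lemma psd_op_closure_range_decomposition:
  fixes P :: "'a::{real_inner, banach} \<Rightarrow> 'a"
  assumes P: "psd_op P"
  obtains d k where "x = d + k" "d \<in> closure (range P)" "P k = 0"
    "\<And>s. s \<in> closure (range P) \<Longrightarrow> inner k s = 0"
proof -
  interpret P: bounded_linear P by (rule psd_opD[OF P])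
  have "subspace (closure (range P))"
    by (intro subspace_closure linear_subspace_image P.linear_axioms subspace_UNIV)
  then obtain d where d: "d \<in> closure (range P)"
    and orth: "\<And>s. s \<in> closure (range P) \<Longrightarrow> inner (x - d) s = 0"
    using orthogonal_projection_exists[OF _ closed_closure] by metis
  have "inner (P (x - d)) (P (x - d)) = inner (x - d) (P (P (x - d)))"
    by (rule psd_opD[OF P])
  also have "\<dots> = 0" by (intro orth closure_subset[THEN subsetD] rangeI)
  finally have "P (x - d) = 0" by simp
  then show ?thesis using that[of d "x - d"] d orth by simp
qed

text \<open>The space splits into the closure of the range of \<open>P\<close> and the kernel of
  \<open>P\<close>. Used for the uniqueness of the polar factor and for the crossed commutation
  relation.\<close>

lemma bounded_linear_eq_on_closure_range:
  fixes f g :: "'a::{real_inner, banach} \<Rightarrow> 'b::real_normed_vector"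
  assumes P: "psd_op P" and f: "bounded_linear f" and g: "bounded_linear g"
    and ran: "\<And>z. f (P z) = g (P z)" and ker: "\<And>k. P k = 0 \<Longrightarrow> f k = g k"
  shows "f = g"
proof
  fix x
  interpret f: bounded_linear f by (fact f)
  interpret g: bounded_linear g by (fact g)
  obtain d k where x: "x = d + k" and d: "d \<in> closure (range P)" and k: "P k = 0"
    using psd_op_closure_range_decomposition[OF P] by metis
  have "closed {x. f x = g x}"
    by (intro closed_Collect_eq f.continuous_on g.continuous_on continuous_intros)
  then have "closure (range P) \<subseteq> {x. f x = g x}"
    by (rule closure_minimal[rotated]) (auto simp: ran)
  with d have "f d = g d" by blast
  with ker[OF k] show "f x = g x" by (simp add: x f.add g.add)
qed

text \<open>The closure of the graph of \<open>P z \<mapsto> T z\<close> is the graph of an isometry on the closure of the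
  range of \<open>P\<close>.\<close>

lemma polar_isometry_exists:
  fixes P :: "'a::chilbert_space \<Rightarrow> 'a" and T :: "'a \<Rightarrow> 'b::chilbert_space"
  assumes P: "positive_op P" and T: "bounded_clinear T" and norm_eq: "\<And>x. norm (P x) = norm (T x)"
  shows "\<exists>V. bounded_clinear V \<and> partial_isometry V \<and> (\<forall>z. V (P z) = T z) \<and>
    (\<forall>x. V x = 0 \<longleftrightarrow> P x = 0)"
proof -
  have psd: "psd_op P" and Pi: "\<And>x. P (\<i> *\<^sub>C x) = \<i> *\<^sub>C P x"
    using P by (auto simp: positive_op_iff)
  interpret P: bounded_linear P by (rule psd_opD[OF psd])
  interpret T: bounded_linear T using T by (simp add: bounded_clinear_def)
  have Ti: "T (\<i> *\<^sub>C x) = \<i> *\<^sub>C T x" for x using T by (simp add: bounded_clinear_def)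
  define G where "G = closure (range (\<lambda>z. (P z, T z)))"
  have "bounded_linear (\<lambda>z. (P z, T z))"
    by (intro bounded_linear_Pair P.bounded_linear_axioms T.bounded_linear_axioms)
  then have subG: "subspace G"
    unfolding G_def
    by (intro subspace_closure linear_subspace_image bounded_linear.linear subspace_UNIV)
  have GI: "(P z, T z) \<in> G" for z
    unfolding G_def by (intro closure_subset[THEN subsetD] rangeI)
  have Gnorm: "norm u = norm v" if "(u, v) \<in> G" for u v
  proof -
    have "closed {p::'a \<times> 'b. norm (fst p) = norm (snd p)}"
      by (intro closed_Collect_eq continuous_intros)
    then have "G \<subseteq> {p. norm (fst p) = norm (snd p)}"
      unfolding G_def by (rule closure_minimal[rotated]) (auto simp: norm_eq)
    with that show ?thesis by auto
  qed
  have Gdiff: "(u - u', v - v') \<in> G" if "(u, v) \<in> G" "(u', v') \<in> G" for u v u' v'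
    using subspace_diff[OF subG that] by simp
  \<comment> \<open>Single-valuedness: the pair \<open>(0, v - v')\<close> lies in \<open>G\<close>,
    where both components have the same norm.\<close>
  have Gfun: "v = v'" if "(u, v) \<in> G" "(u, v') \<in> G" for u v v'
    using Gnorm[OF Gdiff[OF that]] by simp
  have Gi: "(\<i> *\<^sub>C u, \<i> *\<^sub>C v) \<in> G" if "(u, v) \<in> G" for u v
  proof -
    have "(\<lambda>p. \<i> *\<^sub>C p) ` G \<subseteq> G"
      unfolding G_def
    proof (rule image_closure_subset)
      show "continuous_on (closure (range (\<lambda>z. (P z, T z)))) (\<lambda>p. \<i> *\<^sub>C p)"
        by (rule bounded_linear.continuous_on[OF bounded_linear_scaleC_i continuous_on_id])
      show "(\<lambda>p. \<i> *\<^sub>C p) ` range (\<lambda>z. (P z, T z)) \<subseteq> closure (range (\<lambda>z. (P z, T z)))"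
        using GI by (auto simp: scaleC_prod_def G_def simp flip: Pi Ti)
    qed simp
    then have "\<i> *\<^sub>C (u, v) \<in> G" using that by blast
    then show ?thesis by (simp add: scaleC_prod_def)
  qed
  have Gclosure: "u \<in> closure (range P)" if "(u, v) \<in> G" for u v
  proof -
    have "fst ` G \<subseteq> closure (range P)"
      unfolding G_def
      by (intro image_closure_subset continuous_intros closed_closure)
        (auto intro: closure_subset[THEN subsetD])
    with that show ?thesis by force
  qed
  have Gdom: "\<exists>v. (u, v) \<in> G" if u: "u \<in> closure (range P)" for u
  proof -
    obtain w where w: "(\<lambda>n. P (w n)) \<longlonglongrightarrow> u"
      by (rule closure_rangeE[OF u])
    have "Cauchy (\<lambda>n. P (w n))" using w by (rule LIMSEQ_imp_Cauchy)
    then have "Cauchy (\<lambda>n. T (w n))"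
      unfolding Cauchy_iff by (simp add: norm_eq flip: P.diff T.diff)
    then obtain v where v: "(\<lambda>n. T (w n)) \<longlonglongrightarrow> v"
      using Cauchy_convergent_iff convergent_def by blast
    have "(\<lambda>n. (P (w n), T (w n))) \<longlonglongrightarrow> (u, v)"
      by (intro tendsto_Pair w v)
    then have "(u, v) \<in> G"
      unfolding G_def by (rule closed_sequentially[OF closed_closure GI[unfolded G_def]])
    then show ?thesis ..
  qed
  have "\<exists>d k v. x = d + k \<and> P k = 0 \<and> (d, v) \<in> G" for x
  proof -
    obtain d k where "x = d + k" "d \<in> closure (range P)" "P k = 0"
      by (rule psd_op_closure_range_decomposition[OF psd])
    with Gdom[of d] show ?thesis by blast
  qed
  \<comment> \<open>The three witnesses are packed into one triple so that a single choice function
    provides them all.\<close>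
  then have "\<forall>x. \<exists>p. x = fst p + fst (snd p) \<and> P (fst (snd p)) = 0 \<and> (fst p, snd (snd p)) \<in> G"
    by simp
  from choice[OF this] obtain p where p: "\<forall>x. x = fst (p x) + fst (snd (p x)) \<and> P (fst (snd (p x))) = 0 \<and>
      (fst (p x), snd (snd (p x))) \<in> G" ..
  define D K V where "D x = fst (p x)" and "K x = fst (snd (p x))" and "V x = snd (snd (p x))" for x
  have V: "x = D x + K x" "P (K x) = 0" "(D x, V x) \<in> G" for x
    using p unfolding D_def K_def V_def by blast+
  have orth: "inner k u = 0" if "P k = 0" "(u, v) \<in> G" for k u v
  proof -
    have "closed {u. inner k u = 0}"
      by (intro closed_Collect_eq continuous_intros)
    moreover have "inner k (P z) = 0" for z
      using psd_opD(2)[OF psd, of k z] that(1) by simp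
    ultimately have "closure (range P) \<subseteq> {u. inner k u = 0}"
      by (intro closure_minimal) auto
    with Gclosure[OF that(2)] show ?thesis by blast
  qed
  \<comment> \<open>Independence of the choices: two decompositions differ by a vector that is both
    in the kernel of \<open>P\<close> and a first component in \<open>G\<close>, so it is orthogonal
    to itself.\<close>
  have VI: "V (u + k) = v" if "(u, v) \<in> G" "P k = 0" for u v k
  proof -
    have G: "(u - D (u + k), v - V (u + k)) \<in> G" by (rule Gdiff[OF that(1) V(3)])
    have "u - D (u + k) = K (u + k) - k"
      using V(1)[of "u + k"] by (simp add: algebra_simps)
    then have "P (u - D (u + k)) = 0"
      using V(2) that(2) by (simp add: P.diff)
    from orth[OF this G] have "u - D (u + k) = 0" by simp
    with Gnorm[OF G] show ?thesis by simp
  qed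
  have "bounded_linear V"
  proof (rule bounded_linear_intro)
    show "V (x + y) = V x + V y" for x y
    proof -
      have "(D x + D y, V x + V y) \<in> G"
        using subspace_add[OF subG V(3)[of x] V(3)[of y]] by simp
      moreover have "P (K x + K y) = 0" by (simp add: P.add V(2))
      ultimately have "V (D x + D y + (K x + K y)) = V x + V y" by (rule VI)
      moreover have "D x + D y + (K x + K y) = x + y"
        using V(1)[of x] V(1)[of y] by (simp add: algebra_simps)
      ultimately show ?thesis by simp
    qed
    show "V (r *\<^sub>R x) = r *\<^sub>R V x" for r x
    proof -
      have "(r *\<^sub>R D x, r *\<^sub>R V x) \<in> G"
        using subspace_scale[OF subG V(3)[of x], of r] by simp
      moreover have "P (r *\<^sub>R K x) = 0" by (simp add: P.scaleR V(2))
      ultimately have "V (r *\<^sub>R D x + r *\<^sub>R K x) = r *\<^sub>R V x" by (rule VI)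
      then show ?thesis using V(1)[of x] by (simp flip: scaleR_add_right)
    qed
    show "norm (V x) \<le> norm x * 1" for x
    proof -
      have "inner (K x) (D x) = 0" by (rule orth[OF V(2) V(3)])
      then have "(norm (D x + K x))\<^sup>2 = (norm (D x))\<^sup>2 + (norm (K x))\<^sup>2"
        by (simp add: power2_norm_eq_inner inner_add_left inner_add_right inner_commute[of "D x" "K x"])
      then have "(norm x)\<^sup>2 = (norm (D x))\<^sup>2 + (norm (K x))\<^sup>2"
        by (simp flip: V(1))
      then have "(norm (D x))\<^sup>2 \<le> (norm x)\<^sup>2" by simp
      with Gnorm[OF V(3)[of x]] show ?thesis by simp
    qed
  qed
  moreover have "V (\<i> *\<^sub>C x) = \<i> *\<^sub>C V x" for x
  proof -
    have "P (\<i> *\<^sub>C K x) = 0" by (simp add: Pi V(2))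
    from VI[OF Gi[OF V(3)[of x]] this] V(1)[of x] show ?thesis
      by (simp flip: scaleC_add_right)
  qed
  ultimately have clin: "bounded_clinear V" by (simp add: bounded_clinear_iff)
  have ker: "V x = 0 \<longleftrightarrow> P x = 0" for x
  proof
    assume "V x = 0"
    then have "D x = 0" using Gnorm[OF V(3)[of x]] by simp
    then show "P x = 0" using V(1)[of x] V(2)[of x] by simp
  next
    assume "P x = 0"
    then show "V x = 0"
      using VI[of 0 0 x] subspace_0[OF subG] by (simp add: zero_prod_def)
  qed
  have iso: "partial_isometry V"
    unfolding partial_isometry_def
  proof (intro conjI allI impI clin)
    fix x
    assume "\<forall>z\<in>op_ker V. cinner x z = 0"
    then have "inner x (K x) = 0"
      using ker V(2) by (simp add: op_ker_def inner_eq_Re_cinner)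
    moreover have "inner (K x) (D x) = 0" by (rule orth[OF V(2) V(3)])
    moreover have "inner x (K x) = inner (D x) (K x) + inner (K x) (K x)"
      by (simp flip: inner_add_left V(1))
    ultimately have "K x = 0" by (simp add: inner_commute[of "D x" "K x"])
    then have "D x = x" using V(1)[of x] by simp
    then show "norm (V x) = norm x" using Gnorm[OF V(3)[of x]] by simp
  qed
  have VP: "V (P z) = T z" for z
    using VI[OF GI[of z], of 0] by simp
  show ?thesis
    by (intro exI[of _ V] conjI allI clin iso VP ker)
qed

text \<open>The defining conditions fix the column of \<open>V\<close> on the range of
  \<open>P\<close> and make it vanish on the kernel, so it is unique by density. The definite
  description is therefore the isometry constructed above.\<close>

lemma polar_part_props:
  fixes T :: "('a::chilbert_space \<Rightarrow> 'a) \<times> ('a \<Rightarrow> 'a)"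
  assumes T: "bounded_clinear (fst T)" "bounded_clinear (snd T)"
  shows "bounded_clinear (fst (polar_part T))" "bounded_clinear (snd (polar_part T))"
    and "fst (polar_part T) (joint_modulus T x) = fst T x"
    and "snd (polar_part T) (joint_modulus T x) = snd T x"
    and "joint_modulus T k = 0 \<Longrightarrow> fst (polar_part T) k = 0"
    and "joint_modulus T k = 0 \<Longrightarrow> snd (polar_part T) k = 0"
proof -
  let ?P = "joint_modulus T"
  define Q where "Q V \<longleftrightarrow> column T = column V \<circ> ?P \<and> partial_isometry (column V) \<and>
    op_ker (fst T) \<inter> op_ker (snd T) = op_ker (fst V) \<inter> op_ker (snd V) \<and>
    op_ker (fst V) \<inter> op_ker (snd V) = op_ker ?P" for V
  have P: "positive_op ?P" by (rule positive_joint_modulus[OF T])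
  have norm_eq: "norm (?P x) = norm (column T x)" for x by (rule norm_joint_modulus[OF T])
  have clinT: "bounded_clinear (column T)"
    using T by (simp add: bounded_clinear_iff column_def scaleC_prod_def bounded_linear_Pair)
  have kerT: "op_ker (fst T) \<inter> op_ker (snd T) = op_ker ?P"
  proof (rule set_eqI)
    fix x
    have "?P x = 0 \<longleftrightarrow> column T x = 0" using norm_eq[of x] by (metis norm_eq_zero)
    then show "x \<in> op_ker (fst T) \<inter> op_ker (snd T) \<longleftrightarrow> x \<in> op_ker ?P"
      by (simp add: op_ker_def column_def zero_prod_def)
  qed
  obtain W where W: "bounded_clinear W" "\<And>z. W (?P z) = column T z"
      "\<And>x. W x = 0 \<longleftrightarrow> ?P x = 0" "partial_isometry W"
    using polar_isometry_exists[OF P clinT norm_eq] by metis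
  define V where "V = (fst \<circ> W, snd \<circ> W)"
  have colV: "column V = W" by (simp add: V_def column_def)
  have kerV: "op_ker (fst V) \<inter> op_ker (snd V) = op_ker ?P"
  proof (rule set_eqI)
    fix x
    show "x \<in> op_ker (fst V) \<inter> op_ker (snd V) \<longleftrightarrow> x \<in> op_ker ?P"
      using W(3)[of x] by (simp add: op_ker_def V_def prod_eq_iff)
  qed
  have "Q V"
    unfolding Q_def colV kerV kerT using W(2,4) by (simp add: fun_eq_iff)
  moreover have "V' = V" if "Q V'" for V'
  proof -
    have "column V' = column V"
    proof (rule bounded_linear_eq_on_closure_range)
      show "psd_op ?P" using P by (simp add: positive_op_iff)
      show "bounded_linear (column V')" "bounded_linear (column V)"
        using that \<open>Q V\<close> unfolding Q_def partial_isometry_def bounded_clinear_def by blast+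
      show "column V' (?P z) = column V (?P z)" for z
      proof -
        have "column V' \<circ> ?P = column V \<circ> ?P"
          using that \<open>Q V\<close> unfolding Q_def by argo
        from fun_cong[OF this, of z] show ?thesis by simp
      qed
      show "column V' k = column V k" if k: "?P k = 0" for k
      proof -
        have "k \<in> op_ker (fst V') \<inter> op_ker (snd V')" "k \<in> op_ker (fst V) \<inter> op_ker (snd V)"
        proof -
          have "op_ker (fst V') \<inter> op_ker (snd V') = op_ker ?P" using that \<open>Q V'\<close> unfolding Q_def by argo
          moreover have "k \<in> op_ker ?P" using k by (simp add: op_ker_def)
          ultimately show "k \<in> op_ker (fst V') \<inter> op_ker (snd V')"
            "k \<in> op_ker (fst V) \<inter> op_ker (snd V)" using kerV by blast+
        qed
        then show ?thesis by (simp add: column_def op_ker_def)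
      qed
    qed
    then show ?thesis by (simp add: column_def fun_eq_iff prod_eq_iff)
  qed
  ultimately have "polar_part T = V"
    unfolding polar_part_def Q_def[symmetric] by (rule the_equality)
  moreover have "bounded_clinear (fst V)" "bounded_clinear (snd V)"
    using W(1) unfolding bounded_clinear_iff V_def
    by (auto simp: o_def scaleC_prod_def intro: bounded_linear_fst_comp bounded_linear_snd_comp)
  moreover have "fst V (?P x) = fst T x" "snd V (?P x) = snd T x" for x
    using W(2) by (simp_all add: V_def column_def)
  moreover have "fst V k = 0" "snd V k = 0" if "?P k = 0" for k
    using W(3)[of k] that by (simp_all add: V_def)
  ultimately show "bounded_clinear (fst (polar_part T))" "bounded_clinear (snd (polar_part T))"
    "fst (polar_part T) (?P x) = fst T x" "snd (polar_part T) (?P x) = snd T x"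
    "?P k = 0 \<Longrightarrow> fst (polar_part T) k = 0" "?P k = 0 \<Longrightarrow> snd (polar_part T) k = 0"
    by simp_all
qed

subsection \<open>Koszul complexes\<close>

text \<open>Exactness is purely algebraic, so the comparison of complexes uses linearity without
  boundedness.\<close>

abbreviation clinear :: "('a::complex_vector \<Rightarrow> 'b::complex_vector) \<Rightarrow> bool" where
  "clinear \<equiv> Vector_Spaces.linear scaleC scaleC"

lemma clinearI:
  assumes "\<And>x y. f (x + y) = f x + f y" "\<And>a x. f (a *\<^sub>C x) = a *\<^sub>C f x"
  shows "clinear f"
  using assms by unfold_locales

lemma bounded_clinear_clinear: "bounded_clinear f \<Longrightarrow> clinear f"
  by (rule clinearI) (simp_all add: bounded_clinear_def linear_simps)

lemma clinear_shift: "clinear f \<Longrightarrow> clinear (\<lambda>x. f x - l *\<^sub>C x)"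
proof (rule clinearI)
  assume "clinear f"
  then interpret f: Vector_Spaces.linear scaleC scaleC f .
  show "f (x + y) - l *\<^sub>C (x + y) = f x - l *\<^sub>C x + (f y - l *\<^sub>C y)" for x y
    by (simp add: f.add scaleC_add_right)
  show "f (a *\<^sub>C x) - l *\<^sub>C a *\<^sub>C x = a *\<^sub>C (f x - l *\<^sub>C x)" for a x
    by (simp add: f.scale complex_vector.scale_right_diff_distrib scaleC_scaleC mult.commute)
qed

lemma clinear_compose: "clinear f \<Longrightarrow> clinear g \<Longrightarrow> clinear (\<lambda>x. f (g x))"
  using Vector_Spaces.linear_compose[of scaleC scaleC g scaleC f] by (simp add: o_def)

text \<open>The conjuncts are exactness at the left, middle and right spots. The backward half of
  the middle equivalence expresses that \<open>A\<close> and \<open>B\<close> commute.\<close>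

lemma taylor_invertible_iff:
  assumes "clinear A" "clinear B"
  shows "taylor_invertible (A, B) \<longleftrightarrow>
    (\<forall>x. A x = 0 \<and> B x = 0 \<longrightarrow> x = 0) \<and>
    (\<forall>x y. A y = B x \<longleftrightarrow> (\<exists>z. x = A z \<and> y = B z)) \<and>
    (\<forall>w. \<exists>x y. w = A y - B x)"
proof -
  interpret A: Vector_Spaces.linear scaleC scaleC A by (fact assms)
  interpret B: Vector_Spaces.linear scaleC scaleC B by (fact assms)
  have "op_ker (column (A, B)) = {0} \<longleftrightarrow> (\<forall>x. A x = 0 \<and> B x = 0 \<longrightarrow> x = 0)"
    by (auto simp: op_ker_def column_def zero_prod_def)
  moreover have "range (column (A, B)) = op_ker (koszul_row (A, B)) \<longleftrightarrow>
      (\<forall>x y. A y = B x \<longleftrightarrow> (\<exists>z. x = A z \<and> y = B z))"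
    by (auto simp: set_eq_iff op_ker_def koszul_row_def column_def image_iff)
  moreover have "range (koszul_row (A, B)) = UNIV \<longleftrightarrow> (\<forall>w. \<exists>x y. w = A y - B x)"
    by (auto simp: set_eq_iff koszul_row_def image_iff)
  ultimately show ?thesis by (simp add: taylor_invertible_def)
qed

text \<open>Exchanging the operators alters the complex only by a coordinate swap and signs. It
  reduces a nonzero second coordinate of \<lambda> to a nonzero first one.\<close>

lemma taylor_invertible_swap:
  assumes "clinear A" "clinear B" "taylor_invertible (A, B)"
  shows "taylor_invertible (B, A)"
proof -
  interpret A: Vector_Spaces.linear scaleC scaleC A by (fact assms)
  interpret B: Vector_Spaces.linear scaleC scaleC B by (fact assms)
  from assms have inj: "\<forall>x. A x = 0 \<and> B x = 0 \<longrightarrow> x = 0"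
    and ex: "\<forall>x y. A y = B x \<longleftrightarrow> (\<exists>z. x = A z \<and> y = B z)"
    and surj: "\<forall>w. \<exists>x y. w = A y - B x"
    using taylor_invertible_iff[OF assms(1,2)] by blast+
  have surj': "\<exists>x y. w = B y - A x" for w
  proof -
    obtain x y where "w = A y - B x" using surj by blast
    then have "w = B (- x) - A (- y)" by (simp add: A.neg B.neg)
    then show ?thesis by blast
  qed
  have ex': "B y = A x \<longleftrightarrow> (\<exists>z. x = B z \<and> y = A z)" for x y
    using ex[rule_format, of x y] by (simp only: eq_commute[of "B y" "A x"] conj_commute)
  show ?thesis
    unfolding taylor_invertible_iff[OF assms(2,1)]
  proof (intro conjI allI impI)
    fix x assume "B x = 0 \<and> A x = 0"
    then have "A x = 0 \<and> B x = 0" by simp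
    then show "x = 0" by (rule inj[rule_format])
  qed (rule ex', rule surj')
qed

text \<open>If \<open>F\<close> and \<open>G\<close> are chain maps between two Koszul complexes and \<open>G \<circ> F\<close> is homotopic to
  a nonzero multiple of the identity, then exactness is inherited.\<close>

lemma taylor_invertible_transfer:
  fixes F :: "'a::chilbert_space \<Rightarrow> 'b::chilbert_space"
  assumes S: "clinear A" "clinear B" and S': "clinear A'" "clinear B'"
    and F: "clinear F" and G: "clinear G"
    and comm: "\<And>x. A (B x) = B (A x)"
    and FA: "\<And>x. F (A x) = A' (F x)" and FB: "\<And>x. F (B x) = B' (F x)"
    and GA: "\<And>x. G (A' x) = A (G x)" and GB: "\<And>x. G (B' x) = B (G x)"
    and GF: "\<And>x. G (F x) = c *\<^sub>C x + b *\<^sub>C A x" and "c \<noteq> 0"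
    and inv: "taylor_invertible (A', B')"
  shows "taylor_invertible (A, B)"
proof -
  interpret A: Vector_Spaces.linear scaleC scaleC A by (fact S)
  interpret B: Vector_Spaces.linear scaleC scaleC B by (fact S)
  interpret F: Vector_Spaces.linear scaleC scaleC F by (fact F)
  interpret G: Vector_Spaces.linear scaleC scaleC G by (fact G)
  from inv have inj: "\<And>x. A' x = 0 \<Longrightarrow> B' x = 0 \<Longrightarrow> x = 0"
    and ex: "\<And>x y. A' y = B' x \<Longrightarrow> \<exists>z. x = A' z \<and> y = B' z"
    and surj: "\<And>w. \<exists>x y. w = A' y - B' x"
    unfolding taylor_invertible_iff[OF S'] by blast+
  define d where "d = inverse c"
  have cancel: "x = d *\<^sub>C (c *\<^sub>C x)" for x :: 'a
    using \<open>c \<noteq> 0\<close> by (simp add: d_def scaleC_scaleC scaleC_one)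
  have c_eq: "c *\<^sub>C x = G (F x) - b *\<^sub>C A x" for x
    by (simp add: GF)
  show ?thesis
    unfolding taylor_invertible_iff[OF S]
  proof (intro conjI allI impI iffI)
    fix x
    assume x: "A x = 0 \<and> B x = 0"
    have "F x = 0"
      by (rule inj) (use x in \<open>simp_all add: F.zero flip: FA FB\<close>)
    then have "c *\<^sub>C x = 0" using x by (simp add: c_eq G.zero)
    then show "x = 0" using \<open>c \<noteq> 0\<close> by simp
  next
    fix x y
    assume xy: "A y = B x"
    then have "A' (F y) = B' (F x)" by (simp flip: FA FB)
    then obtain z where z: "F x = A' z" "F y = B' z" using ex by blast
    have "c *\<^sub>C x = A (G z - b *\<^sub>C x)"
      by (simp add: c_eq z GA A.diff A.scale)
    \<comment> \<open>Since \<open>A y = B x\<close>, the homotopy term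
      \<open>b *\<^sub>C A y\<close> equals \<open>B (b *\<^sub>C x)\<close>, so one witness serves
      both coordinates.\<close>
    moreover have "c *\<^sub>C y = B (G z - b *\<^sub>C x)"
      by (simp add: c_eq z GB B.diff B.scale xy)
    ultimately have "d *\<^sub>C c *\<^sub>C x = A (d *\<^sub>C (G z - b *\<^sub>C x))"
        "d *\<^sub>C c *\<^sub>C y = B (d *\<^sub>C (G z - b *\<^sub>C x))"
      by (simp_all only: A.scale B.scale)
    then have "x = A (d *\<^sub>C (G z - b *\<^sub>C x))" "y = B (d *\<^sub>C (G z - b *\<^sub>C x))"
      by (simp_all only: cancel[symmetric])
    then show "\<exists>z. x = A z \<and> y = B z" by blast
  next
    fix x y
    assume "\<exists>z. x = A z \<and> y = B z"
    then show "A y = B x" using comm by auto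
  next
    fix w
    obtain u v where uv: "F w = A' v - B' u" using surj by blast
    have "c *\<^sub>C w = A (G v - b *\<^sub>C w) - B (G u)"
      by (simp add: c_eq uv G.diff GA GB A.diff A.scale)
    then have "d *\<^sub>C (c *\<^sub>C w) = A (d *\<^sub>C (G v - b *\<^sub>C w)) - B (d *\<^sub>C G u)"
      by (simp only: A.scale B.scale A.diff complex_vector.scale_right_diff_distrib)
    then have "w = A (d *\<^sub>C (G v - b *\<^sub>C w)) - B (d *\<^sub>C G u)"
      by (simp only: cancel[symmetric])
    then show "\<exists>x y. w = A y - B x" by blast
  qed
qed

text \<open>\<open>C\<close> and \<open>A\<close> are chain maps in opposite directions, the latter
  by the crossed relation. Their composites are \<open>l\<close> plus the first operator of the
  respective pair, hence the transfer with \<open>c = l\<close> and \<open>b = 1\<close>.\<close>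

lemma taylor_invertible_criss_cross:
  fixes A B C :: "'a::chilbert_space \<Rightarrow> 'a"
  assumes lin: "clinear A" "clinear B" "clinear C"
    and crs: "\<And>x. A (C (B x)) = B (C (A x))" and "l \<noteq> 0"
  shows "taylor_invertible (\<lambda>x. A (C x) - l *\<^sub>C x, \<lambda>x. B (C x) - m *\<^sub>C x) \<longleftrightarrow>
    taylor_invertible (\<lambda>x. C (A x) - l *\<^sub>C x, \<lambda>x. C (B x) - m *\<^sub>C x)"
proof -
  interpret A: Vector_Spaces.linear scaleC scaleC A by (fact lin)
  interpret B: Vector_Spaces.linear scaleC scaleC B by (fact lin)
  interpret C: Vector_Spaces.linear scaleC scaleC C by (fact lin)
  note l = lin clinear_shift clinear_compose
  note s = A.diff B.diff C.diff A.scale B.scale C.scale crs scaleC_one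
    complex_vector.scale_right_diff_distrib complex_vector.scale_left_commute
  show ?thesis
  proof
    assume "taylor_invertible (\<lambda>x. C (A x) - l *\<^sub>C x, \<lambda>x. C (B x) - m *\<^sub>C x)"
    then show "taylor_invertible (\<lambda>x. A (C x) - l *\<^sub>C x, \<lambda>x. B (C x) - m *\<^sub>C x)"
      by (rule taylor_invertible_transfer[where F = C and G = A and c = l and b = 1, rotated -1])
        (simp_all add: l s \<open>l \<noteq> 0\<close>)
  next
    assume "taylor_invertible (\<lambda>x. A (C x) - l *\<^sub>C x, \<lambda>x. B (C x) - m *\<^sub>C x)"
    then show "taylor_invertible (\<lambda>x. C (A x) - l *\<^sub>C x, \<lambda>x. C (B x) - m *\<^sub>C x)"
      by (rule taylor_invertible_transfer[where F = A and G = C and c = l and b = 1, rotated -1])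
        (simp_all add: l s \<open>l \<noteq> 0\<close>)
  qed
qed

text \<open>Transfer along \<open>R\<close> and its inverse, whose composites are the identity:
  \<open>c = 1\<close> with zero homotopy.\<close>

lemma taylor_invertible_similar:
  fixes R :: "'a::chilbert_space \<Rightarrow> 'b::chilbert_space"
  assumes S: "clinear A" "clinear B" and S': "clinear A'" "clinear B'"
    and R: "clinear R" "bij R"
    and comm: "\<And>x. A (B x) = B (A x)" "\<And>x. A' (B' x) = B' (A' x)"
    and RA: "\<And>x. R (A x) = A' (R x)" and RB: "\<And>x. R (B x) = B' (R x)"
  shows "taylor_invertible (A, B) \<longleftrightarrow> taylor_invertible (A', B')"
proof -
  interpret R: Vector_Spaces.linear scaleC scaleC R by (fact R)
  have inv1: "R (inv R x) = x" for x using R(2) by (simp add: bij_is_surj surj_f_inv_f)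
  have inv2: "inv R (R x) = x" for x using R(2) by (simp add: bij_is_inj)
  have lin: "clinear (inv R)"
  proof (rule clinearI)
    show "inv R (x + y) = inv R x + inv R y" for x y
      by (metis R.add inv1 inv2)
    show "inv R (a *\<^sub>C x) = a *\<^sub>C inv R x" for a x
      by (metis R.scale inv1 inv2)
  qed
  have invA: "inv R (A' x) = A (inv R x)" for x by (metis RA inv1 inv2)
  have invB: "inv R (B' x) = B (inv R x)" for x by (metis RB inv1 inv2)
  note z = complex_vector.scale_zero_left scaleC_one
  show ?thesis
  proof
    assume "taylor_invertible (A', B')"
    then show "taylor_invertible (A, B)"
      by (rule taylor_invertible_transfer[OF S S' R(1) lin comm(1) RA RB invA invB, where c = 1 and b = 0, rotated -1])
        (simp_all add: inv2 z)
  next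
    assume "taylor_invertible (A, B)"
    then show "taylor_invertible (A', B')"
      by (rule taylor_invertible_transfer[OF S' S lin R(1) comm(2) invA invB RA RB, where c = 1 and b = 0, rotated -1])
        (simp_all add: inv1 z)
  qed
qed

section \<open>Surjectivity forced by exactness\<close>

text \<open>The kernel of a symmetric operator is orthogonal to its range.\<close>

lemma psd_op_surj_imp_bij:
  assumes "psd_op R" "surj R"
  shows "bij R"
proof -
  interpret R: bounded_linear R by (rule psd_opD[OF assms(1)])
  have "x = 0" if "R x = 0" for x
  proof -
    obtain z where "x = R z" using assms(2) by (metis surjD)
    then have "inner x x = inner (R x) z" using psd_opD(2)[OF assms(1), of x z] by simp
    with that show ?thesis by simp
  qed
  then have "inj R"
    by (intro injI) (metis R.diff eq_iff_diff_eq_0)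
  with assms(2) show ?thesis by (simp add: bij_def)
qed

text \<open>The range of the column is a kernel, hence closed. As \<open>P\<close> has the same norms, its range is
  closed too, and it is dense because \<open>P\<close> is injective and symmetric.\<close>

lemma surj_of_taylor_invertible:
  fixes P A B :: "'a::chilbert_space \<Rightarrow> 'a"
  assumes P: "psd_op P" and A: "bounded_linear A" and B: "bounded_linear B"
    and norm_eq: "\<And>x. norm (P x) = norm (column (A, B) x)"
    and inv: "taylor_invertible (A, B)"
  shows "surj P"
proof -
  let ?c = "column (A, B)"
  interpret P: bounded_linear P by (rule psd_opD[OF P])
  interpret c: bounded_linear ?c
    unfolding column_def fst_conv snd_conv by (rule bounded_linear_Pair[OF A B])
  have "closed {p. - B (fst p) + A (snd p) = 0}"
    by (intro closed_Collect_eq continuous_intros bounded_linear.continuous_on[OF A]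
        bounded_linear.continuous_on[OF B])
  moreover have "op_ker (koszul_row (A, B)) = {p. - B (fst p) + A (snd p) = 0}"
    by (auto simp: op_ker_def koszul_row_def)
  ultimately have closed_range: "closed (range ?c)"
    using inv by (simp add: taylor_invertible_def)
  have closed: "u \<in> range P" if u: "u \<in> closure (range P)" for u
  proof -
    obtain w where w: "(\<lambda>n. P (w n)) \<longlonglongrightarrow> u"
      by (rule closure_rangeE[OF u])
    have "Cauchy (\<lambda>n. P (w n))" using w by (rule LIMSEQ_imp_Cauchy)
    then have "Cauchy (\<lambda>n. ?c (w n))"
      unfolding Cauchy_iff by (simp add: norm_eq flip: P.diff c.diff)
    then obtain v where v: "(\<lambda>n. ?c (w n)) \<longlonglongrightarrow> v"
      using Cauchy_convergent_iff convergent_def by blast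
    have "v \<in> range ?c"
      by (rule closed_sequentially[OF closed_range _ v]) simp
    then obtain z where z: "v = ?c z" by blast
    have "(\<lambda>n. norm (?c (w n) - v)) \<longlonglongrightarrow> 0"
      by (intro tendsto_norm_zero LIM_zero v)
    then have "(\<lambda>n. norm (P (w n) - P z)) \<longlonglongrightarrow> 0"
      by (simp add: z norm_eq flip: P.diff c.diff)
    then have "(\<lambda>n. P (w n)) \<longlonglongrightarrow> P z"
      by (rule LIM_zero_cancel[OF tendsto_norm_zero_cancel])
    with w have "u = P z" by (rule LIMSEQ_unique)
    then show ?thesis by simp
  qed
  have ker: "k = 0" if "P k = 0" for k
  proof -
    have "?c k = 0" using norm_eq[of k] that by simp
    then show ?thesis using inv by (auto simp: taylor_invertible_def op_ker_def)
  qed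
  have "x \<in> range P" for x
  proof -
    obtain d k where "x = d + k" "d \<in> closure (range P)" "P k = 0"
      by (rule psd_op_closure_range_decomposition[OF P])
    with closed[of d] ker[of k] show ?thesis by simp
  qed
  then show ?thesis by blast
qed

section \<open>Equality of the two Taylor spectra\<close>

theorem theorem2p8:
  fixes T1 T2 :: "'a::chilbert_space \<Rightarrow> 'a"
  assumes "\<nexists>B :: 'a set. finite B \<and> cspan B = UNIV"
    and "commuting_pair (T1, T2)"
  shows "taylor_spectrum (T1, T2) = taylor_spectrum (spherical_aluthge (T1, T2))"
proof -
  have T: "bounded_clinear T1" "bounded_clinear T2" and comm: "T1 (T2 x) = T2 (T1 x)" for x
    using assms(2) by (simp_all add: commuting_pair_def fun_eq_iff)
  define P where "P = joint_modulus (T1, T2)"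
  define R where "R = op_sqrt P"
  define V1 V2 where "V1 = fst (polar_part (T1, T2))" and "V2 = snd (polar_part (T1, T2))"
  have posP: "positive_op P" and norm_eq: "\<And>x. norm (P x) = norm (column (T1, T2) x)"
    using joint_modulus_props[of "(T1, T2)"] T by (simp_all add: P_def)
  then have posR: "positive_op R" and RR: "\<And>x. R (R x) = P x"
    using positive_op_sqrt[OF posP] by (simp_all add: R_def fun_eq_iff)
  have psdP: "psd_op P" and psdR: "psd_op R"
    using posP posR by (simp_all add: positive_op_iff)
  have V: "bounded_clinear V1" "bounded_clinear V2"
    and VP: "\<And>x. V1 (P x) = T1 x" "\<And>x. V2 (P x) = T2 x"
    and Vker: "\<And>k. P k = 0 \<Longrightarrow> V1 k = 0" "\<And>k. P k = 0 \<Longrightarrow> V2 k = 0"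
    using polar_part_props[of "(T1, T2)"] T unfolding V1_def V2_def P_def by simp_all
  have bP: "bounded_clinear P" and bR: "bounded_clinear R"
    using posP posR by (simp_all add: positive_op_def)
  note bl = V bP bR T
  have cl: "clinear V1" "clinear V2" "clinear P" "clinear R" "clinear T1" "clinear T2"
    by (intro bounded_clinear_clinear bl)+
  interpret V1: Vector_Spaces.linear scaleC scaleC V1 by (fact cl)
  interpret V2: Vector_Spaces.linear scaleC scaleC V2 by (fact cl)
  interpret P: Vector_Spaces.linear scaleC scaleC P by (fact cl)
  have "(\<lambda>x. V1 (P (V2 x))) = (\<lambda>x. V2 (P (V1 x)))"
  proof (rule bounded_linear_eq_on_closure_range[OF psdP])
    show "bounded_linear (\<lambda>x. V1 (P (V2 x)))"
      by (intro bounded_linear_compose[OF bl(1)[THEN bounded_clinear_bounded_linear]]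
          bounded_linear_compose[OF bl(3)[THEN bounded_clinear_bounded_linear]]
          bl(2)[THEN bounded_clinear_bounded_linear])
    show "bounded_linear (\<lambda>x. V2 (P (V1 x)))"
      by (intro bounded_linear_compose[OF bl(2)[THEN bounded_clinear_bounded_linear]]
          bounded_linear_compose[OF bl(3)[THEN bounded_clinear_bounded_linear]]
          bl(1)[THEN bounded_clinear_bounded_linear])
    \<comment> \<open>The two sides are \<open>T1 (T2 z)\<close> and \<open>T2 (T1 z)\<close>; only
      here does commutativity of the pair enter the crossed relation.\<close>
    show "V1 (P (V2 (P z))) = V2 (P (V1 (P z)))" for z
      by (simp add: VP comm)
    show "V1 (P (V2 k)) = V2 (P (V1 k))" if "P k = 0" for k
      by (simp add: Vker[OF that] V1.zero V2.zero P.zero)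
  qed
  then have cross: "V1 (P (V2 x)) = V2 (P (V1 x))" for x
    by (rule fun_cong)
  \<comment> \<open>The crossed relation
    \<open>A\<^sub>1 R A\<^sub>2 = A\<^sub>2 R A\<^sub>1\<close> for
    \<open>A\<^sub>i = V\<^sub>i R\<close>, in the shape required by the comparison lemma with
    \<open>C = R\<close>.\<close>
  have crs: "V1 (R (R (V2 (R x)))) = V2 (R (R (V1 (R x))))" for x
    by (simp add: RR cross)
  have T_eq: "T1 x = V1 (R (R x))" "T2 x = V2 (R (R x))" for x
    by (simp_all add: RR VP)
  have aluthge: "spherical_aluthge (T1, T2) = (\<lambda>x. R (V1 (R x)), \<lambda>x. R (V2 (R x)))"
    by (simp add: spherical_aluthge_def Let_def R_def P_def V1_def V2_def fun_eq_iff)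
  have lin: "clinear (\<lambda>x. R (V1 (R x)))" "clinear (\<lambda>x. R (V2 (R x)))"
    by (rule clinear_compose[OF cl(4) clinear_compose[OF cl(1,4)]]
        clinear_compose[OF cl(4) clinear_compose[OF cl(2,4)]])+
  let ?T = "\<lambda>l m. taylor_invertible (\<lambda>x. T1 x - l *\<^sub>C x, \<lambda>x. T2 x - m *\<^sub>C x)"
  let ?A = "\<lambda>l m. taylor_invertible (\<lambda>x. R (V1 (R x)) - l *\<^sub>C x, \<lambda>x. R (V2 (R x)) - m *\<^sub>C x)"
  have "?T l m \<longleftrightarrow> ?A l m" for l m
  proof -
    consider "l \<noteq> 0" | "m \<noteq> 0" | "l = 0" "m = 0" by blast
    then show ?thesis
    proof cases
      case 1
      show ?thesis
        unfolding T_eq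
        by (rule taylor_invertible_criss_cross[OF
              clinear_compose[OF cl(1,4)] clinear_compose[OF cl(2,4)] cl(4) crs 1])
    next
      case 2
      have swap: "taylor_invertible (A, B) \<longleftrightarrow> taylor_invertible (B, A)"
        if "clinear A" "clinear B" for A B :: "'a \<Rightarrow> 'a"
        using taylor_invertible_swap that by blast
      have "?T l m \<longleftrightarrow> taylor_invertible (\<lambda>x. T2 x - m *\<^sub>C x, \<lambda>x. T1 x - l *\<^sub>C x)"
        by (intro swap clinear_shift cl)
      also have "\<dots> \<longleftrightarrow> taylor_invertible
          (\<lambda>x. R (V2 (R x)) - m *\<^sub>C x, \<lambda>x. R (V1 (R x)) - l *\<^sub>C x)"
        unfolding T_eq
        by (rule taylor_invertible_criss_cross[OF
              clinear_compose[OF cl(2,4)] clinear_compose[OF cl(1,4)] cl(4) crs[symmetric] 2])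
      also have "\<dots> \<longleftrightarrow> ?A l m"
        by (intro swap clinear_shift lin)
      finally show ?thesis .
    next
      case 3
      \<comment> \<open>\<open>R\<close> intertwines the pairs because
        \<open>R T\<^sub>i = (R V\<^sub>i R) R\<close>, so a bijective \<open>R\<close> is a
        similarity.\<close>
      have similar: "taylor_invertible (T1, T2) \<longleftrightarrow>
          taylor_invertible (\<lambda>x. R (V1 (R x)), \<lambda>x. R (V2 (R x)))" if "surj R"
      proof (rule taylor_invertible_similar)
        show "bij R" by (rule psd_op_surj_imp_bij[OF psdR that])
        show "clinear T1" "clinear T2" "clinear R" by (rule cl)+
        show "clinear (\<lambda>x. R (V1 (R x)))" "clinear (\<lambda>x. R (V2 (R x)))" by (rule lin)+
        show "R (V1 (R (R (V2 (R x))))) = R (V2 (R (R (V1 (R x)))))" for x by (simp only: crs)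
        show "T1 (T2 x) = T2 (T1 x)" for x by (rule comm)
        show "R (T1 x) = R (V1 (R (R x)))" "R (T2 x) = R (V2 (R (R x)))" for x
          by (simp_all only: T_eq)
      qed
      have "surj R" if "taylor_invertible (T1, T2)"
      proof -
        \<comment> \<open>The closed range argument applies to \<open>P\<close>, which has the norms
          of the column; \<open>P = R R\<close> passes surjectivity on to \<open>R\<close>.\<close>
        have "surj P"
          by (rule surj_of_taylor_invertible[OF psdP _ _ norm_eq that])
            (use T in \<open>simp_all add: bounded_clinear_def\<close>)
        then have "y \<in> range R" for y
          using RR by (metis rangeI surjD)
        then show ?thesis by blast
      qed
      moreover have "surj R" if "taylor_invertible (\<lambda>x. R (V1 (R x)), \<lambda>x. R (V2 (R x)))"
      proof -
        interpret R: Vector_Spaces.linear scaleC scaleC R by (fact cl)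
        \<comment> \<open>Exactness at the right spot: every vector is a difference of values of
          \<open>R\<close>, hence itself one.\<close>
        have "\<exists>x y. w = R (V1 (R y)) - R (V2 (R x))" for w
          using that unfolding taylor_invertible_iff[OF lin] by blast
        then have "w \<in> range R" for w
          by (metis R.diff rangeI)
        then show ?thesis by blast
      qed
      ultimately show ?thesis
        using similar 3 by (auto simp: complex_vector.scale_zero_left)
    qed
  qed
  then show ?thesis
    by (simp add: taylor_spectrum_def aluthge)
qed

end
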